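(* Let $m\in\mathbb Z_{\ge1}$, let $T$ be a bounded $m$-isometry on a complex separable Hilbert space $\mathcal H$ with a cyclic unit vector $e$, and let $\vec\mu=(\mu_0,\ldots,\mu_{m-1})$ be the corresponding $m$-tuple of distributions on $\mathbb T$, i.e. $\hat\mu_n(k)=\overline{\hat\mu_n(-k)}=\langle\beta_n(T)e,T^ke\rangle_{\mathcal H}$ for $k\in\mathbb Z_{\ge0}$, $0\le n\le m-1$. (i) For $0\le n\le m-2$, there is a constant $C$ such that $|\hat\mu_n(k)|\le C(1+|k|)^{\frac{m-1}2}$ for all $k\in\mathbb Z$. (ii) For $n=0$, $\hat\mu_0(0)\ge0$, with equality if and only if every $\mu_n=0$. (iii) For $n=m-1$, $\mu_{m-1}\ge0$ (that is, $\mu_{m-1}$ is a finite positive measure), and $$\langle\beta_{m-1}(T)f(T)e,f(T)e\rangle_{\mathcal H}=\int_{\mathbb T}|f|^2\,d\mu_{m-1}$$ whenever $f\in\mathcal D_a$.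
   Context: For a bounded operator $T$ on a Hilbert space, $\beta_n(T)=\sum_{j=0}^n(-1)^{n-j}\binom njT^{*j}T^j$; $T$ is an $m$-isometry if $\beta_m(T)=0$. A vector $e$ is cyclic for $T$ if the closed linear span of $\{T^ke:k\ge0\}$ is the whole space. Distributions $\mu$ on the unit circle $\mathbb T$ are identified with their Fourier coefficients $\hat\mu(k)=\mu(\zeta^{-k})$, $k\in\mathbb Z$, which may be any sequence of at most polynomial growth. $\mathcal D_a$ is the space of functions analytic on the open unit disc and smooth on its closure; $f(z)=\sum_{k\ge0}\hat f(k)z^k$ with rapidly decaying coefficients. For an $m$-isometry $T$ the norms $\|T^k\|$ grow at most polynomially, and $f(T)=\sum_{k\ge0}\hat f(k)T^k$ for $f\in\mathcal D_a$. A distribution $\mu$ is positive if $\mu(g)\ge0$ for all smooth $g\ge0$; such a distribution is integration against a finite positive measure. *)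

theory Defs
  imports "HOL-Analysis.Analysis"
begin

section \<open>Complex Hilbert spaces\<close>

text \<open>
  The complex inner product is linear in its first argument. Norm and topology are those of the
  underlying real inner product space, whose inner product is the real part of the complex one.
\<close>

class complex_hilbert = banach + real_inner +
  fixes scaleC :: "complex \<Rightarrow> 'a \<Rightarrow> 'a" (infixr "*\<^sub>C" 75)
    and cinner :: "'a \<Rightarrow> 'a \<Rightarrow> complex"
  assumes scaleC_add_right: "a *\<^sub>C (x + y) = a *\<^sub>C x + a *\<^sub>C y"
    and scaleC_add_left: "(a + b) *\<^sub>C x = a *\<^sub>C x + b *\<^sub>C x"
    and scaleC_scaleC: "a *\<^sub>C (b *\<^sub>C x) = (a * b) *\<^sub>C x"
    and scaleR_scaleC: "scaleR r x = complex_of_real r *\<^sub>C x"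
    and cinner_add_left: "cinner (x + y) z = cinner x z + cinner y z"
    and cinner_scaleC_left: "cinner (a *\<^sub>C x) y = a * cinner x y"
    and cinner_commute: "cinner x y = cnj (cinner y x)"
    and inner_eq_Re_cinner: "inner x y = Re (cinner x y)"

interpretation complex_vector: vector_space "scaleC :: complex \<Rightarrow> 'a \<Rightarrow> 'a::complex_hilbert"
proof
  fix x :: 'a
  show "1 *\<^sub>C x = x"
    using scaleR_scaleC[of 1 x] by simp
qed (auto simp: scaleC_add_right scaleC_add_left scaleC_scaleC)

definition bounded_clinear :: "('a::complex_hilbert \<Rightarrow> 'a) \<Rightarrow> bool" where
  "bounded_clinear T \<longleftrightarrow> bounded_linear T \<and> (\<forall>c x. T (c *\<^sub>C x) = c *\<^sub>C T x)"

text \<open>For bounded complex-linear \<open>T\<close> such an \<open>S\<close> exists and is unique (Riesz).\<close>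

definition cadjoint :: "('a::complex_hilbert \<Rightarrow> 'a) \<Rightarrow> 'a \<Rightarrow> 'a" where
  "cadjoint T = (SOME S. \<forall>x y. cinner (T x) y = cinner x (S y))"

definition beta :: "nat \<Rightarrow> ('a::complex_hilbert \<Rightarrow> 'a) \<Rightarrow> 'a \<Rightarrow> 'a" where
  "beta n T x =
    (\<Sum>j\<le>n. ((-1) ^ (n - j) * real (n choose j)) *\<^sub>R (cadjoint T ^^ j) ((T ^^ j) x))"

definition m_isometry :: "nat \<Rightarrow> ('a::complex_hilbert \<Rightarrow> 'a) \<Rightarrow> bool" where
  "m_isometry m T \<longleftrightarrow> bounded_clinear T \<and> (\<forall>x. beta m T x = 0)"

definition cyclic_vector :: "('a::complex_hilbert \<Rightarrow> 'a) \<Rightarrow> 'a \<Rightarrow> bool" where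
  "cyclic_vector T e \<longleftrightarrow> closure (complex_vector.span (range (\<lambda>k. (T ^^ k) e))) = UNIV"


section \<open>Distributions on the unit circle\<close>

text \<open>
  A function on the unit circle is represented by a function on \<open>complex\<close> whose values off
  the circle are irrelevant; \<open>circle_deriv k g t\<close> is the \<open>k\<close>-th derivative of \<open>\<lambda>t. g (cis t)\<close>.
\<close>

definition circle_deriv :: "nat \<Rightarrow> (complex \<Rightarrow> complex) \<Rightarrow> real \<Rightarrow> complex" where
  "circle_deriv k g = ((\<lambda>h t. vector_derivative h (at t)) ^^ k) (\<lambda>t. g (cis t))"

definition smooth_on_circle :: "(complex \<Rightarrow> complex) \<Rightarrow> bool" where
  "smooth_on_circle g \<longleftrightarrow> (\<forall>k t. circle_deriv k g differentiable (at t))"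

text \<open>
  Distributions are the linear functionals on the smooth functions that are continuous for the
  seminorms \<open>SUP t. cmod (circle_deriv j g t)\<close>. The bound also forces \<open>\<mu> g\<close> to depend only on the
  restriction of \<open>g\<close> to the circle; \<open>\<mu> g\<close> is irrelevant when \<open>g\<close> is not smooth on the circle.
\<close>

definition distribution :: "((complex \<Rightarrow> complex) \<Rightarrow> complex) \<Rightarrow> bool" where
  "distribution \<mu> \<longleftrightarrow>
    (\<forall>g h. smooth_on_circle g \<longrightarrow> smooth_on_circle h \<longrightarrow> \<mu> (\<lambda>z. g z + h z) = \<mu> g + \<mu> h) \<and>
    (\<forall>c g. smooth_on_circle g \<longrightarrow> \<mu> (\<lambda>z. c * g z) = c * \<mu> g) \<and>
    (\<exists>C N. \<forall>g. smooth_on_circle g \<longrightarrow>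
       cmod (\<mu> g) \<le> C * (\<Sum>j\<le>N. SUP t. cmod (circle_deriv j g t)))"

definition fourier_coeff :: "((complex \<Rightarrow> complex) \<Rightarrow> complex) \<Rightarrow> int \<Rightarrow> complex" where
  "fourier_coeff \<mu> k = \<mu> (\<lambda>z. z powi (- k))"

definition zero_distribution :: "((complex \<Rightarrow> complex) \<Rightarrow> complex) \<Rightarrow> bool" where
  "zero_distribution \<mu> \<longleftrightarrow> (\<forall>g. smooth_on_circle g \<longrightarrow> \<mu> g = 0)"

definition positive_distribution :: "((complex \<Rightarrow> complex) \<Rightarrow> complex) \<Rightarrow> bool" where
  "positive_distribution \<mu> \<longleftrightarrow>
    (\<forall>g. smooth_on_circle g \<longrightarrow> (\<forall>z\<in>sphere 0 1. g z \<in> \<real>\<^sub>\<ge>\<^sub>0) \<longrightarrow> \<mu> g \<in> \<real>\<^sub>\<ge>\<^sub>0)"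

definition represents :: "complex measure \<Rightarrow> ((complex \<Rightarrow> complex) \<Rightarrow> complex) \<Rightarrow> bool" where
  "represents M \<mu> \<longleftrightarrow>
    finite_measure M \<and> space M = sphere 0 1 \<and> sets M = sets (restrict_space borel (sphere 0 1)) \<and>
    (\<forall>g. smooth_on_circle g \<longrightarrow> \<mu> g = (LINT z|M. g z))"


section \<open>Functional calculus\<close>

definition analytic_smooth :: "(complex \<Rightarrow> complex) set" where
  "analytic_smooth = {f. f holomorphic_on ball 0 1 \<and> continuous_on (cball 0 1) f \<and>
     (\<forall>k. \<exists>F. continuous_on (cball 0 1) F \<and> (\<forall>z\<in>ball 0 1. F z = (deriv ^^ k) f z))}"

definition taylor_coeff :: "(complex \<Rightarrow> complex) \<Rightarrow> nat \<Rightarrow> complex" where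
  "taylor_coeff f k = (deriv ^^ k) f 0 / fact k"

definition fun_calc :: "(complex \<Rightarrow> complex) \<Rightarrow> ('a::complex_hilbert \<Rightarrow> 'a) \<Rightarrow> 'a \<Rightarrow> 'a" where
  "fun_calc f T x = (\<Sum>k. taylor_coeff f k *\<^sub>C (T ^^ k) x)"

end

theory Submission
  imports Defs "HOL-Probability.Helly_Selection" "HOL-Complex_Analysis.Cauchy_Integral_Formula"
begin

text \<open>
  Let \<open>B n x y = cinner (beta n T x) y\<close>. These forms are iterated differences,
  \<open>B (n + 1) x y = B n (T x) (T y) - B n x y\<close>, and \<open>B m = 0\<close>. Newton's expansion therefore
  gives \<open>cinner ((T ^^ k) x) ((T ^^ k) y) = (\<Sum>j<m. (k choose j) * B j x y)\<close>
  (\<open>cinner_funpow_eq_sum_beta_form\<close>), a polynomial in \<open>k\<close> of degree at most \<open>m - 1\<close>.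

  The first two parts follow at once. The norm of \<open>(T ^^ k) e\<close> grows at most like \<open>k\<close> to the power
  \<open>(m - 1) / 2\<close>, and the coefficients are controlled by the Cauchy--Schwarz inequality. Since \<open>e\<close> is a
  unit vector, the coefficient of \<open>\<mu> 0\<close> at \<open>0\<close> is \<open>1\<close>, so that neither side of the equivalence can hold.

  For the third part, put \<open>B = B (m - 1)\<close>. Taking \<open>x = y\<close> in the polynomial above, its values are
  squared norms, so its leading coefficient is nonnegative: \<open>B\<close> is positive semidefinite
  (\<open>beta_form_top_nonneg\<close>). As \<open>B m = 0\<close>, it is also invariant under \<open>T\<close>. Hence the numbers
  \<open>B ((T ^^ j) e) ((T ^^ l) e)\<close> depend only on \<open>j - l\<close> and form a positive definite sequence, and the
  Herglotz theorem provides a finite measure on the circle with these Fourier coefficients. The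
  distribution \<open>\<mu> (m - 1)\<close> and this measure agree on the monomials \<open>z powi k\<close>. Trigonometric polynomials
  are dense in the smooth functions for each seminorm that occurs in the continuity of a
  distribution, so the measure represents the distribution (\<open>represents_if_fourier_coeff\<close>);
  positivity is then immediate.

  Finally, the identity for \<open>fun_calc f T e\<close> holds for polynomials \<open>f\<close> because both sides are the same
  double sum. It extends to smooth \<open>f\<close> since the Taylor coefficients decay faster than the
  orbit of \<open>e\<close> grows (\<open>beta_form_fun_calc\<close>).
\<close>

section \<open>Complex inner products and adjoints\<close>

lemma cinner_add_right: "cinner x (y + z) = cinner x y + cinner x (z::'a::complex_hilbert)"
  by (metis cinner_commute cinner_add_left complex_cnj_add)

lemma cinner_scaleC_right: "cinner x (a *\<^sub>C y) = cnj a * cinner x (y::'a::complex_hilbert)"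
  by (metis cinner_commute cinner_scaleC_left complex_cnj_mult)

lemma cinner_self: "cinner x x = complex_of_real ((norm (x::'a::complex_hilbert))\<^sup>2)"
proof (rule complex_eqI)
  show "Re (cinner x x) = Re (complex_of_real ((norm x)\<^sup>2))"
    by (simp flip: inner_eq_Re_cinner add: power2_norm_eq_inner)
  show "Im (cinner x x) = Im (complex_of_real ((norm x)\<^sup>2))"
    using arg_cong[OF cinner_commute[of x x], of Im] by simp
qed

lemma norm_scaleC: "norm (a *\<^sub>C x) = cmod a * norm (x::'a::complex_hilbert)"
proof -
  have "complex_of_real ((norm (a *\<^sub>C x))\<^sup>2) = a * cnj a * complex_of_real ((norm x)\<^sup>2)"
    by (simp only: cinner_self[symmetric] cinner_scaleC_left cinner_scaleC_right mult_ac)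
  also have "\<dots> = complex_of_real ((cmod a * norm x)\<^sup>2)"
    by (simp only: complex_norm_square[symmetric] power_mult_distrib of_real_mult of_real_power)
  finally have "(norm (a *\<^sub>C x))\<^sup>2 = (cmod a * norm x)\<^sup>2"
    using of_real_eq_iff by blast
  then show ?thesis
    by (simp add: power2_eq_iff_nonneg)
qed

lemma cmod_cinner_le: "cmod (cinner x y) \<le> norm x * norm (y::'a::complex_hilbert)"
proof (cases "cinner x y = 0")
  case False
  \<comment> \<open>rotate \<open>x\<close> by the unimodular \<open>u\<close> that makes the inner product real, then use the real inequality\<close>
  define c where "c = cinner x y"
  define u where "u = cnj (sgn c)"
  have "c \<noteq> 0" using False by (simp add: c_def)
  then have u1: "cmod u = 1" by (simp add: u_def norm_sgn)
  have "c = cmod c *\<^sub>R sgn c" using \<open>c \<noteq> 0\<close> by (simp add: sgn_div_norm)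
  then have "u * c = cmod c *\<^sub>R (u * cnj u)"
    by (metis complex_cnj_cnj mult_scaleR_right u_def)
  then have u2: "u * cinner x y = cmod (cinner x y)"
    using u1 by (simp add: c_def scaleR_conv_of_real flip: complex_norm_square)
  have "cmod (cinner x y) = inner (u *\<^sub>C x) y"
    using u2 by (simp add: inner_eq_Re_cinner cinner_scaleC_left)
  also have "\<dots> \<le> norm (u *\<^sub>C x) * norm y"
    by (rule norm_cauchy_schwarz)
  finally show ?thesis
    using u1 by (simp add: norm_scaleC)
qed simp

lemma bounded_bilinear_cinner: "bounded_bilinear (cinner :: 'a::complex_hilbert \<Rightarrow> 'a \<Rightarrow> complex)"
  by standard (auto simp: cinner_add_left cinner_add_right scaleR_scaleC cinner_scaleC_left
      cinner_scaleC_right scaleR_conv_of_real intro!: exI[of _ 1] cmod_cinner_le)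

interpretation cinner: bounded_bilinear "cinner :: 'a::complex_hilbert \<Rightarrow> 'a \<Rightarrow> complex"
  by (rule bounded_bilinear_cinner)

text \<open>
  Minimise \<open>J x = (norm x)\<^sup>2 / 2 - f x\<close>. The parallelogram law makes every minimising sequence
  Cauchy, and at the minimum \<open>u\<close> the vanishing of the first variation says \<open>f h = inner u h\<close>.
\<close>

lemma Riesz_real:
  fixes f :: "'a::{banach,real_inner} \<Rightarrow> real"
  assumes "bounded_linear f"
  obtains u where "\<And>x. f x = inner u x"
proof -
  interpret f: bounded_linear f by fact
  define J where "J x = (norm x)\<^sup>2 / 2 - f x" for x
  obtain K where K: "\<And>x. norm (f x) \<le> norm x * K"
    using f.bounded by blast
  have J_ge: "J x \<ge> - (K\<^sup>2 / 2)" for x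
  proof -
    have "0 \<le> (norm x - K)\<^sup>2" by simp
    then show ?thesis
      using K[of x] by (simp add: J_def power2_diff field_simps)
  qed
  define a where "a = (INF x. J x)"
  have bdd: "bdd_below (range J)"
    using J_ge by (auto intro!: bdd_belowI)
  have a_le: "a \<le> J x" for x
    unfolding a_def by (rule cINF_lower[OF bdd]) simp
  have "\<exists>x. J x < a + 1 / real (Suc n)" for n
  proof -
    have "a < a + 1 / real (Suc n)" by simp
    then show ?thesis
      unfolding a_def using cINF_less_iff[OF _ bdd] by blast
  qed
  then obtain x where x: "\<And>n. J (x n) < a + 1 / real (Suc n)"
    by metis
  have par: "(norm (y - z))\<^sup>2 \<le> 4 * (J y - a) + 4 * (J z - a)" for y z
  proof -
    have "(norm (y - z))\<^sup>2 = 4 * J y + 4 * J z - 8 * J ((1/2) *\<^sub>R (y + z))"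
      by (simp add: J_def power2_norm_eq_inner f.add f.scaleR inner_diff_left inner_diff_right
          inner_add_left inner_add_right inner_commute algebra_simps add_divide_distrib diff_divide_distrib)
    then show ?thesis
      using a_le[of "(1/2) *\<^sub>R (y + z)"] by simp
  qed
  have "Cauchy x"
  proof (rule metric_CauchyI)
    fix e :: real assume "e > 0"
    then obtain N where N: "1 / real (Suc N) < e\<^sup>2 / 8"
      by (metis nat_approx_posE zero_less_divide_iff zero_less_numeral zero_less_power)
    have "dist (x i) (x j) < e" if "N \<le> i" "N \<le> j" for i j
    proof -
      have *: "J (x i) - a < e\<^sup>2 / 8" if "N \<le> i" for i
      proof -
        have "1 / real (Suc i) \<le> 1 / real (Suc N)"
          using that by (simp add: frac_le)
        then show ?thesis using x[of i] N by linarith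
      qed
      note par[of "x i" "x j"]
      also have "4 * (J (x i) - a) + 4 * (J (x j) - a) < 4 * (e\<^sup>2 / 8) + 4 * (e\<^sup>2 / 8)"
        using *[OF that(1)] *[OF that(2)] by (intro add_strict_mono mult_strict_left_mono) auto
      also have "\<dots> = e\<^sup>2"
        by simp
      finally have "(norm (x i - x j))\<^sup>2 < e\<^sup>2" .
      then show ?thesis
        unfolding dist_norm using \<open>e > 0\<close> by (intro power_less_imp_less_base[of _ 2 e]) auto
    qed
    then show "\<exists>M. \<forall>m\<ge>M. \<forall>n\<ge>M. dist (x m) (x n) < e" by blast
  qed
  then obtain u where u: "x \<longlonglongrightarrow> u"
    using Cauchy_convergent_iff convergent_def by blast
  have "(\<lambda>n. J (x n)) \<longlonglongrightarrow> J u"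
    unfolding J_def by (intro tendsto_intros f.tendsto u) simp
  moreover have "(\<lambda>n. a + 1 / real (Suc n)) \<longlonglongrightarrow> a + 0"
    by (intro tendsto_intros LIMSEQ_Suc lim_1_over_n)
  ultimately have Ju: "J u \<le> a"
    using LIMSEQ_le[of "\<lambda>n. J (x n)" "J u" "\<lambda>n. a + 1 / real (Suc n)" "a + 0"] x
    by (auto intro: less_imp_le)
  have "f h = inner u h" for h
  proof (rule ccontr)
    assume neq: "f h \<noteq> inner u h"
    then have h: "h \<noteq> 0" by auto
    define d where "d = f h - inner u h"
    define t where "t = d / (norm h)\<^sup>2"
    have "(norm (u + t *\<^sub>R h))\<^sup>2 = (norm u)\<^sup>2 + 2 * t * inner u h + t\<^sup>2 * (norm h)\<^sup>2"
      unfolding power2_norm_eq_inner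
      by (simp add: inner_add_left inner_add_right inner_commute[of h u] power2_eq_square
          algebra_simps)
    then have "J (u + t *\<^sub>R h) = J u + t\<^sup>2 * (norm h)\<^sup>2 / 2 - t * d"
      by (simp add: J_def f.add f.scaleR d_def field_simps)
    also have "\<dots> = J u - d\<^sup>2 / (2 * (norm h)\<^sup>2)"
      using h by (simp add: t_def power2_eq_square field_simps)
    also have "\<dots> < J u"
      using h neq by (simp add: d_def)
    finally show False
      using a_le[of "u + t *\<^sub>R h"] Ju by simp
  qed
  then show thesis by (rule that)
qed

text \<open>
  The real part of \<open>f\<close> is represented by some \<open>u\<close>; evaluating it at \<open>\<i> *\<^sub>C x\<close> shows that the
  imaginary part is represented by the same \<open>u\<close>.
\<close>

lemma Riesz_complex:
  fixes f :: "'a::complex_hilbert \<Rightarrow> complex"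
  assumes "bounded_linear f" and hom: "\<And>c x. f (c *\<^sub>C x) = c * f x"
  obtains u where "\<And>x. f x = cinner x u"
proof -
  have "bounded_linear (\<lambda>x. Re (f x))"
    using bounded_linear_compose[OF bounded_linear_Re assms(1)] by simp
  then obtain u where u: "\<And>x. Re (f x) = inner u x"
    using Riesz_real by blast
  then have Re: "Re (f x) = Re (cinner x u)" for x
    by (simp add: inner_commute inner_eq_Re_cinner[symmetric])
  have "Im (f x) = Im (cinner x u)" for x
    using Re[of "\<i> *\<^sub>C x"] by (simp add: hom cinner_scaleC_left)
  then have "f x = cinner x u" for x
    using Re by (simp add: complex_eq_iff)
  then show thesis by (rule that)
qed

lemma bounded_clinearD:
  assumes "bounded_clinear T"
  shows "bounded_linear T" "T (c *\<^sub>C x) = c *\<^sub>C T x"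
  using assms by (auto simp: bounded_clinear_def)

lemma bounded_clinear_funpow:
  assumes "bounded_clinear T"
  shows "bounded_clinear (T ^^ n)"
proof (induction n)
  case 0
  then show ?case by (simp add: bounded_clinear_def id_def)
next
  case (Suc n)
  then show ?case
    using assms bounded_linear_compose[of T "T ^^ n"] by (simp add: bounded_clinear_def o_def)
qed

lemma cinner_cadjoint:
  assumes "bounded_clinear T"
  shows "cinner (T x) y = cinner x (cadjoint T y)"
proof -
  have "\<exists>u. \<forall>x. cinner (T x) y = cinner x u" for y
  proof -
    have "bounded_linear (\<lambda>x. cinner (T x) y)"
      using bounded_linear_compose[OF cinner.bounded_linear_left bounded_clinearD(1)[OF assms]]
      by simp
    then show ?thesis
      using Riesz_complex[of "\<lambda>x. cinner (T x) y"]
      by (metis assms bounded_clinearD(2) cinner_scaleC_left)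
  qed
  then have "\<exists>S. \<forall>x y. cinner (T x) y = cinner x (S y)"
    by metis
  then show ?thesis
    unfolding cadjoint_def by (rule someI2_ex) blast
qed

lemma cinner_cadjoint_funpow:
  assumes "bounded_clinear T"
  shows "cinner ((cadjoint T ^^ n) x) y = cinner x ((T ^^ n) y)"
proof (induction n arbitrary: y)
  case (Suc n)
  have "cinner ((cadjoint T ^^ Suc n) x) y = cnj (cinner y (cadjoint T ((cadjoint T ^^ n) x)))"
    by (simp add: cinner_commute[of _ y])
  also have "\<dots> = cinner ((cadjoint T ^^ n) x) (T y)"
    by (simp add: cinner_cadjoint[OF assms, symmetric] cinner_commute[of _ "T y"])
  finally show ?case
    by (simp only: Suc.IH funpow_Suc_right o_apply)
qed simp

section \<open>Difference forms of an m-isometry\<close>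

text \<open>
  The sesquilinear form of \<open>beta n T\<close>. It mentions no adjoint, so that the algebra below is algebra
  of the numbers \<open>cinner ((T ^^ j) x) ((T ^^ j) y)\<close>.
\<close>

definition beta_form :: "nat \<Rightarrow> ('a::complex_hilbert \<Rightarrow> 'a) \<Rightarrow> 'a \<Rightarrow> 'a \<Rightarrow> complex" where
  "beta_form n T x y = (\<Sum>j\<le>n. (-1) ^ (n - j) * of_nat (n choose j) * cinner ((T ^^ j) x) ((T ^^ j) y))"

lemma cinner_beta:
  assumes "bounded_clinear T"
  shows "cinner (beta n T x) y = beta_form n T x y"
  by (simp add: beta_def beta_form_def cinner.sum_left cinner.scaleR_left scaleR_conv_of_real
      cinner_cadjoint_funpow[OF assms])

lemma beta_form_0: "beta_form 0 T x y = cinner x y"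
  by (simp add: beta_form_def)

text \<open>
  Passing from the form \<open>\<langle>X x, y\<rangle>\<close> to \<open>\<langle>X T x, T y\<rangle> - \<langle>X x, y\<rangle>\<close> is a difference operator; \<open>beta_form n T\<close>
  is its \<open>n\<close>-th power applied to the inner product. This is Pascal's rule.
\<close>

lemma beta_form_Suc:
  "beta_form (Suc n) T x y = beta_form n T (T x) (T y) - beta_form n T x y"
proof -
  define g where "g j = cinner ((T ^^ j) x) ((T ^^ j) y)" for j
  have "beta_form (Suc n) T x y = (\<Sum>j\<le>Suc n. (-1) ^ (Suc n - j) * of_nat (Suc n choose j) * g j)"
    by (simp only: beta_form_def g_def)
  also have "\<dots> = (-1) ^ Suc n * g 0 + (\<Sum>j\<le>n. (-1) ^ (n - j) * of_nat (Suc n choose Suc j) * g (Suc j))"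
    by (simp only: sum.atMost_Suc_shift) simp
  also have "\<dots> = (-1) ^ Suc n * g 0 + (\<Sum>j\<le>n. (-1) ^ (n - j) * of_nat (n choose Suc j) * g (Suc j))
        + (\<Sum>j\<le>n. (-1) ^ (n - j) * of_nat (n choose j) * g (Suc j))"
    by (simp add: algebra_simps sum.distrib)
  also have "(\<Sum>j\<le>n. (-1) ^ (n - j) * of_nat (n choose j) * g (Suc j)) = beta_form n T (T x) (T y)"
    by (simp add: beta_form_def g_def funpow_swap1)
  also have "(-1) ^ Suc n * g 0 + (\<Sum>j\<le>n. (-1) ^ (n - j) * of_nat (n choose Suc j) * g (Suc j))
     = (\<Sum>j\<le>Suc n. (-1) ^ (Suc n - j) * of_nat (n choose j) * g j)"
    by (simp only: sum.atMost_Suc_shift) simp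
  also have "\<dots> = (\<Sum>j\<le>n. (-1) ^ (Suc n - j) * of_nat (n choose j) * g j)"
    by simp
  also have "\<dots> = - beta_form n T x y"
    by (auto simp: beta_form_def g_def sum_negf[symmetric] Suc_diff_le intro!: sum.cong)
  finally show ?thesis by simp
qed

text \<open>
  Newton's forward difference expansion of \<open>k \<mapsto> cinner ((T ^^ k) x) ((T ^^ k) y)\<close>.
\<close>

lemma cinner_funpow_eq_sum_beta_form_atMost:
  "cinner ((T ^^ k) x) ((T ^^ k) y) = (\<Sum>j\<le>k. of_nat (k choose j) * beta_form j T x y)"
proof (induction k arbitrary: x y)
  case 0
  then show ?case by (simp add: beta_form_0)
next
  case (Suc k)
  define b where "b j = beta_form j T x y" for j
  have "cinner ((T ^^ Suc k) x) ((T ^^ Suc k) y) = (\<Sum>j\<le>k. of_nat (k choose j) * beta_form j T (T x) (T y))"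
    by (simp only: funpow_Suc_right o_apply Suc.IH)
  also have "\<dots> = (\<Sum>j\<le>k. of_nat (k choose j) * b (Suc j)) + (\<Sum>j\<le>k. of_nat (k choose j) * b j)"
    by (simp add: b_def beta_form_Suc algebra_simps sum.distrib sum_subtractf)
  also have "(\<Sum>j\<le>k. of_nat (k choose j) * b j) = (\<Sum>j\<le>Suc k. of_nat (k choose j) * b j)"
    by simp
  also have "\<dots> = b 0 + (\<Sum>j\<le>k. of_nat (k choose Suc j) * b (Suc j))"
    by (simp only: sum.atMost_Suc_shift) simp
  also have "(\<Sum>j\<le>k. of_nat (k choose j) * b (Suc j)) + (b 0 + (\<Sum>j\<le>k. of_nat (k choose Suc j) * b (Suc j)))
     = b 0 + (\<Sum>j\<le>k. of_nat (Suc k choose Suc j) * b (Suc j))"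
    by (simp add: algebra_simps sum.distrib)
  also have "\<dots> = (\<Sum>j\<le>Suc k. of_nat (Suc k choose j) * b j)"
    by (simp only: sum.atMost_Suc_shift) simp
  finally show ?case by (simp only: b_def)
qed

lemma m_isometryD:
  assumes "m_isometry m T"
  shows "bounded_clinear T" "beta_form m T x y = 0"
  using assms cinner_beta[of T m x y] by (auto simp: m_isometry_def cinner.zero_left)

lemma beta_form_eq_0:
  assumes "m_isometry m T" "m \<le> n"
  shows "beta_form n T x y = 0"
  using assms(2)
proof (induction n arbitrary: x y)
  case 0
  then show ?case using m_isometryD(2)[OF assms(1)] by simp
next
  case (Suc n)
  show ?case
  proof (cases "m = Suc n")
    case False
    then show ?thesis using Suc by (simp add: beta_form_Suc)
  qed (use m_isometryD(2)[OF assms(1)] in simp)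
qed

text \<open>
  For an \<open>m\<close>-isometry the expansion stops after \<open>m\<close> terms, so it is a polynomial in \<open>k\<close> of degree
  less than \<open>m\<close>. Growth of the orbits and positivity of the top form both come from this.
\<close>

lemma cinner_funpow_eq_sum_beta_form:
  assumes "m_isometry m T"
  shows "cinner ((T ^^ k) x) ((T ^^ k) y) = (\<Sum>j<m. of_nat (k choose j) * beta_form j T x y)"
proof -
  have "(\<Sum>j\<le>k. of_nat (k choose j) * beta_form j T x y)
      = (\<Sum>j\<in>{..k} \<inter> {..<m}. of_nat (k choose j) * beta_form j T x y)"
    by (rule sum.mono_neutral_right) (auto intro!: beta_form_eq_0[OF assms])
  also have "\<dots> = (\<Sum>j<m. of_nat (k choose j) * beta_form j T x y)"
    by (rule sum.mono_neutral_left) auto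
  finally show ?thesis
    by (simp add: cinner_funpow_eq_sum_beta_form_atMost)
qed

lemma binomial_le_power: "n choose k \<le> n ^ k"
  by (cases "k \<le> n") (simp_all add: binomial_le_pow binomial_eq_0)

text \<open>
  The squared norm is a polynomial in \<open>k\<close> of degree at most \<open>m - 1\<close>, whence the exponent.
\<close>

lemma norm_funpow_growth:
  assumes "m_isometry m T" "m \<ge> 1"
  obtains C where "C \<ge> 0" "\<And>k. norm ((T ^^ k) x) \<le> C * (1 + real k) powr ((real m - 1) / 2)"
proof -
  define S where "S = (\<Sum>j<m. cmod (beta_form j T x x))"
  have S: "S \<ge> 0" by (simp add: S_def sum_nonneg)
  have sq: "(norm ((T ^^ k) x))\<^sup>2 \<le> S * (1 + real k) ^ (m - 1)" for k
  proof -
    have "(norm ((T ^^ k) x))\<^sup>2 = cmod (cinner ((T ^^ k) x) ((T ^^ k) x))"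
      by (simp only: cinner_self norm_of_real) simp
    also have "\<dots> \<le> (\<Sum>j<m. real (k choose j) * cmod (beta_form j T x x))"
      unfolding cinner_funpow_eq_sum_beta_form[OF assms(1)]
      by (rule order_trans[OF norm_sum]) (simp add: norm_mult)
    also have "\<dots> \<le> (\<Sum>j<m. (1 + real k) ^ (m - 1) * cmod (beta_form j T x x))"
    proof (intro sum_mono mult_right_mono)
      fix j assume "j \<in> {..<m}"
      have "real (k choose j) \<le> real (k ^ j)"
        using binomial_le_power of_nat_mono by blast
      also have "\<dots> \<le> (1 + real k) ^ j"
        by (simp add: power_mono)
      also have "\<dots> \<le> (1 + real k) ^ (m - 1)"
        using \<open>j \<in> {..<m}\<close> by (intro power_increasing) auto
      finally show "real (k choose j) \<le> (1 + real k) ^ (m - 1)" .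
    qed simp
    finally show ?thesis
      by (simp add: S_def sum_distrib_left mult.commute)
  qed
  show thesis
  proof
    fix k
    have "norm ((T ^^ k) x) \<le> sqrt (S * (1 + real k) ^ (m - 1))"
      using sq by (simp add: real_le_rsqrt)
    also have "\<dots> = sqrt S * ((1 + real k) powr (real (m - 1))) powr (1/2)"
      by (simp add: real_sqrt_mult powr_half_sqrt powr_realpow)
    also have "\<dots> = sqrt S * (1 + real k) powr ((real m - 1) / 2)"
      using assms(2) by (simp add: powr_powr)
    finally show "norm ((T ^^ k) x) \<le> sqrt S * (1 + real k) powr ((real m - 1) / 2)" .
  qed (use S in simp)
qed

text \<open>
  A polynomial that is nonnegative at all natural numbers has a nonnegative leading coefficient;
  in the basis of binomial coefficients the leading coefficient is \<open>b d\<close> up to the factor \<open>d!\<close>.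
\<close>

lemma top_Newton_coefficient_nonneg:
  fixes b :: "nat \<Rightarrow> real"
  assumes "\<And>k. (\<Sum>j\<le>d. real (k choose j) * b j) \<ge> 0"
  shows "b d \<ge> 0"
proof (rule ccontr)
  assume "\<not> b d \<ge> 0"
  then have neg: "b d < 0" by simp
  show False
  proof (cases d)
    case 0
    then show False using assms[of 0] neg by simp
  next
    case (Suc p)
    define S where "S = (\<Sum>j\<le>p. \<bar>b j\<bar>)"
    \<comment> \<open>beyond this \<open>k\<close> the top term, at most \<open>(k / d) ^ d * b d\<close>, outweighs the others, at most \<open>S * k ^ p\<close>\<close>
    obtain k where k: "real k > S * real d ^ d / - b d + real d"
      using reals_Archimedean2 by blast
    have "S \<ge> 0" by (simp add: S_def sum_nonneg)
    then have "S * real d ^ d / - b d \<ge> 0" using neg by (simp add: divide_nonneg_neg)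
    then have kd: "d \<le> k" "1 \<le> k" using k Suc by linarith+
    have "(\<Sum>j\<le>p. real (k choose j) * b j) \<le> (\<Sum>j\<le>p. real k ^ p * \<bar>b j\<bar>)"
    proof (intro sum_mono)
      fix j assume "j \<in> {..p}"
      have "real (k choose j) \<le> real (k ^ j)"
        using binomial_le_power of_nat_mono by blast
      also have "\<dots> \<le> real k ^ p"
        using \<open>j \<in> {..p}\<close> kd(2) by (simp add: power_increasing)
      finally have "real (k choose j) * \<bar>b j\<bar> \<le> real k ^ p * \<bar>b j\<bar>"
        by (intro mult_right_mono) auto
      moreover have "real (k choose j) * b j \<le> real (k choose j) * \<bar>b j\<bar>"
        by (intro mult_left_mono) auto
      ultimately show "real (k choose j) * b j \<le> real k ^ p * \<bar>b j\<bar>" by linarith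
    qed
    then have 1: "(\<Sum>j\<le>p. real (k choose j) * b j) \<le> real k ^ p * S"
      by (simp add: S_def sum_distrib_left)
    have 2: "(real k / real d) ^ d \<le> real (k choose d)"
      using binomial_ge_n_over_k_pow_k[OF kd(1)] .
    have "real (k choose d) * b d \<le> (real k / real d) ^ d * b d"
      using 2 neg by (intro mult_right_mono_neg) auto
    then have "0 \<le> real k ^ p * S + (real k / real d) ^ d * b d"
      using 1 assms[of k] Suc by simp
    also have "\<dots> = real k ^ p * (S * real d ^ d + real k * b d) / real d ^ d"
    proof -
      have "real k ^ d = real k ^ p * real k" "real d ^ d \<noteq> 0" by (simp_all add: Suc)
      then show ?thesis by (simp only: power_divide) (simp add: field_simps)
    qed
    finally have "0 \<le> real k ^ p * (S * real d ^ d + real k * b d) / real d ^ d" .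
    moreover have "0 < real k ^ p" "0 < real d ^ d"
      using kd Suc by auto
    ultimately have "0 \<le> S * real d ^ d + real k * b d"
      by (auto simp only: zero_le_divide_iff zero_le_mult_iff)
    moreover have "S * real d ^ d / - b d < real k"
      using k by simp
    then have "S * real d ^ d < real k * - b d"
      using neg by (subst (asm) pos_divide_less_eq) auto
    ultimately show False by simp
  qed
qed

lemma beta_form_hermitian: "beta_form n T y x = cnj (beta_form n T x y)"
  unfolding beta_form_def by (subst cinner_commute) simp

text \<open>
  The squared norm of \<open>(T ^^ k) x\<close> is a nonnegative polynomial in \<open>k\<close> with this top Newton coefficient.
\<close>

lemma beta_form_top_nonneg:
  assumes "m_isometry m T" "m \<ge> 1"
  shows "beta_form (m - 1) T x x \<in> \<real>\<^sub>\<ge>\<^sub>0"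
proof -
  have real: "beta_form j T x x = complex_of_real (Re (beta_form j T x x))" for j
    using beta_form_hermitian[of j T x x] by (metis Reals_cnj_iff of_real_Re)
  have "(\<Sum>j\<le>m - 1. real (k choose j) * Re (beta_form j T x x)) \<ge> 0" for k
  proof -
    have "{..<m} = {..m - 1}" using assms(2) by auto
    then have "(\<Sum>j\<le>m - 1. real (k choose j) * Re (beta_form j T x x))
        = Re (cinner ((T ^^ k) x) ((T ^^ k) x))"
      by (simp add: cinner_funpow_eq_sum_beta_form[OF assms(1)])
    then show ?thesis by (simp add: cinner_self)
  qed
  then have "Re (beta_form (m - 1) T x x) \<ge> 0"
    by (rule top_Newton_coefficient_nonneg)
  then show ?thesis
    using real nonneg_Reals_of_real_iff by metis
qed

lemma beta_form_top_invariant: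
  assumes "m_isometry m T" "m \<ge> 1"
  shows "beta_form (m - 1) T ((T ^^ k) x) ((T ^^ k) y) = beta_form (m - 1) T x y"
proof (induction k)
  case (Suc k)
  then show ?case
    using beta_form_Suc[of "m - 1" T "(T ^^ k) x" "(T ^^ k) y"] m_isometryD(2)[OF assms(1)] assms(2)
    by simp
qed simp

lemma beta_form_tendsto:
  assumes "bounded_clinear T" "(f \<longlongrightarrow> x) F" "(g \<longlongrightarrow> y) F"
  shows "((\<lambda>i. beta_form n T (f i) (g i)) \<longlongrightarrow> beta_form n T x y) F"
  unfolding beta_form_def
  by (intro tendsto_intros cinner.tendsto assms(2,3)
      bounded_linear.tendsto[OF bounded_clinearD(1)[OF bounded_clinear_funpow[OF assms(1)]]])

lemma beta_form_sum:
  assumes "bounded_clinear T"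
  shows "beta_form n T (\<Sum>j\<in>A. a j *\<^sub>C x j) (\<Sum>l\<in>B. b l *\<^sub>C y l)
    = (\<Sum>j\<in>A. \<Sum>l\<in>B. a j * cnj (b l) * beta_form n T (x j) (y l))"
proof -
  have lin: "(T ^^ i) (\<Sum>j\<in>A. a j *\<^sub>C x j) = (\<Sum>j\<in>A. a j *\<^sub>C (T ^^ i) (x j))" for i A a and x :: "'b \<Rightarrow> 'a"
    using bounded_clinearD[OF bounded_clinear_funpow[OF assms]]
    by (simp add: linear_sum bounded_linear.linear)
  have lin': "(T ^^ i) (\<Sum>j\<in>A. a j *\<^sub>C x j) = (\<Sum>j\<in>A. a j *\<^sub>C (T ^^ i) (x j))" for i A a and x :: "'c \<Rightarrow> 'a"
    using bounded_clinearD[OF bounded_clinear_funpow[OF assms]]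
    by (simp add: linear_sum bounded_linear.linear)
  have "beta_form n T (\<Sum>j\<in>A. a j *\<^sub>C x j) (\<Sum>l\<in>B. b l *\<^sub>C y l)
      = (\<Sum>i\<le>n. \<Sum>j\<in>A. \<Sum>l\<in>B. a j * cnj (b l) * ((-1) ^ (n - i) * of_nat (n choose i)
            * cinner ((T ^^ i) (x j)) ((T ^^ i) (y l))))"
    by (simp add: beta_form_def lin lin' cinner.sum_left cinner.sum_right cinner_scaleC_left
        cinner_scaleC_right sum_distrib_left mult_ac)
      (subst sum.swap[of _ B A], rule refl)
  also have "\<dots> = (\<Sum>j\<in>A. \<Sum>i\<le>n. \<Sum>l\<in>B. a j * cnj (b l) * ((-1) ^ (n - i) * of_nat (n choose i)
            * cinner ((T ^^ i) (x j)) ((T ^^ i) (y l))))"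
    by (rule sum.swap)
  also have "\<dots> = (\<Sum>j\<in>A. \<Sum>l\<in>B. \<Sum>i\<le>n. a j * cnj (b l) * ((-1) ^ (n - i) * of_nat (n choose i)
            * cinner ((T ^^ i) (x j)) ((T ^^ i) (y l))))"
    by (intro sum.cong refl sum.swap)
  finally show ?thesis
    by (simp only: beta_form_def sum_distrib_left)
qed

section \<open>Smooth functions of the angle\<close>

abbreviation vd :: "(real \<Rightarrow> complex) \<Rightarrow> real \<Rightarrow> complex" where
  "vd h \<equiv> (\<lambda>t. vector_derivative h (at t))"

definition smooth_real :: "(real \<Rightarrow> complex) \<Rightarrow> bool" where
  "smooth_real h \<longleftrightarrow> (\<forall>k t. (vd ^^ k) h differentiable (at t))"

lemma circle_deriv_eq: "circle_deriv k g = (vd ^^ k) (\<lambda>t. g (cis t))"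
  by (simp add: circle_deriv_def)

lemma smooth_on_circle_iff: "smooth_on_circle g \<longleftrightarrow> smooth_real (\<lambda>t. g (cis t))"
  by (simp add: smooth_on_circle_def smooth_real_def circle_deriv_eq)

lemma smooth_real_vd: "smooth_real h \<Longrightarrow> smooth_real (vd h)"
  unfolding smooth_real_def by (metis comp_apply funpow_Suc_right)

lemma smooth_real_has_vd: "smooth_real h \<Longrightarrow> (h has_vector_derivative vd h t) (at t)"
  unfolding smooth_real_def by (metis funpow_0 vector_derivative_works)

lemma smooth_real_continuous: "smooth_real h \<Longrightarrow> continuous_on UNIV h"
  by (meson continuous_at_imp_continuous_on has_vector_derivative_continuous smooth_real_has_vd)

text \<open>
  The operator \<open>vd\<close> is additive only where the derivatives exist, so smoothness of both summands is
  what lets the iterates distribute over the sum.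
\<close>

lemma vd_funpow_add:
  assumes "smooth_real f" "smooth_real g"
  shows "(vd ^^ k) (\<lambda>t. f t + g t) = (\<lambda>t. (vd ^^ k) f t + (vd ^^ k) g t)"
proof (induction k)
  case (Suc k)
  then show ?case
    using assms by (simp add: smooth_real_def)
qed simp

lemma smooth_real_add: "smooth_real f \<Longrightarrow> smooth_real g \<Longrightarrow> smooth_real (\<lambda>t. f t + g t)"
  using vd_funpow_add by (simp add: smooth_real_def)

lemma vd_funpow_cmult:
  assumes "smooth_real f"
  shows "(vd ^^ k) (\<lambda>t. c * f t) = (\<lambda>t. c * (vd ^^ k) f t)"
proof (induction k)
  case (Suc k)
  then show ?case
    using assms by (simp add: smooth_real_def)
qed simp

lemma smooth_real_cmult: "smooth_real f \<Longrightarrow> smooth_real (\<lambda>t. c * f t)"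
  using vd_funpow_cmult[of f _ c] by (simp add: smooth_real_def differentiable_mult)

lemma smooth_real_diff:
  assumes "smooth_real f" "smooth_real g"
  shows "smooth_real (\<lambda>t. f t - g t)"
  using smooth_real_add[OF assms(1) smooth_real_cmult[OF assms(2), of "-1"]] by simp

lemma has_vector_derivative_cis_mult:
  "((\<lambda>t. c * cis (a * t)) has_vector_derivative (c * (\<i> * of_real a)) * cis (a * t)) (at t)"
proof -
  have "((\<lambda>z. c * exp (\<i> * a * z)) has_field_derivative c * (exp (\<i> * a * of_real t) * (\<i> * a))) (at (of_real t))"
    by (auto intro!: derivative_eq_intros)
  from has_vector_derivative_real_field[OF this] show ?thesis
    by (simp add: cis_conv_exp mult_ac)
qed

lemma vd_funpow_cis:
  "(vd ^^ n) (\<lambda>t. c * cis (a * t)) = (\<lambda>t. c * (\<i> * of_real a) ^ n * cis (a * t))"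
proof (induction n)
  case (Suc n)
  then show ?case
    using vector_derivative_at[OF has_vector_derivative_cis_mult[of "c * (\<i> * of_real a) ^ n" a]]
    by (simp add: mult_ac)
qed simp

lemma smooth_real_cis: "smooth_real (\<lambda>t. c * cis (a * t))"
  unfolding smooth_real_def vd_funpow_cis
  by (blast intro: differentiableI_vector has_vector_derivative_cis_mult)

lemma smooth_real_const: "smooth_real (\<lambda>t. c)"
  using smooth_real_cis[of c 0] by simp

lemma vd_funpow_const: "(vd ^^ n) (\<lambda>t. c) = (\<lambda>t. if n = 0 then c else 0)"
  using vd_funpow_cis[of n c 0] by (auto simp: power_0_left)

section \<open>Density of trigonometric polynomials\<close>

inductive trig_poly :: "(real \<Rightarrow> complex) \<Rightarrow> bool" where
  monom: "trig_poly (\<lambda>t. c * cis (of_int k * t))"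
| add: "trig_poly p \<Longrightarrow> trig_poly q \<Longrightarrow> trig_poly (\<lambda>t. p t + q t)"

lemma trig_poly_const: "trig_poly (\<lambda>t. c)"
  using monom[of c 0] by simp

lemma trig_poly_monom_mult: "trig_poly p \<Longrightarrow> trig_poly (\<lambda>t. c * cis (of_int k * t) * p t)"
proof (induction rule: trig_poly.induct)
  case (monom d l)
  have "c * cis (of_int k * t) * (d * cis (of_int l * t)) = c * d * cis (of_int (k + l) * t)" for t
    by (simp add: cis_mult[symmetric] distrib_right)
  then show ?case
    using trig_poly.monom[of "c * d" "k + l"] by (simp only:)
next
  case (add p q)
  show ?case
    using trig_poly.add[OF add.IH] by (simp add: algebra_simps)
qed

lemma trig_poly_mult:
  assumes "trig_poly p" "trig_poly q"
  shows "trig_poly (\<lambda>t. p t * q t)"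
  using assms(1)
proof (induction rule: trig_poly.induct)
  case (monom c k)
  show ?case by (rule trig_poly_monom_mult[OF assms(2)])
next
  case (add p p')
  then show ?case
    using trig_poly.add[OF add.IH(1,2)] by (simp add: algebra_simps)
qed

lemma smooth_real_trig_poly: "trig_poly p \<Longrightarrow> smooth_real p"
  by (induction rule: trig_poly.induct) (auto intro: smooth_real_cis smooth_real_add)

lemma cis_add_2pi: "cis (of_int k * (t + 2 * pi)) = cis (of_int k * t)"
proof -
  have "cis (of_int k * (t + 2 * pi)) = cis (of_int k * t) * cis (2 * pi * of_int k)"
    by (simp only: cis_mult) (simp add: algebra_simps)
  then show ?thesis by simp
qed

lemma trig_poly_periodic: "trig_poly p \<Longrightarrow> p (t + 2 * pi) = p t"
  by (induction rule: trig_poly.induct) (simp_all only: cis_add_2pi)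

text \<open>
  Every term except the constant one has a trigonometric antiderivative; \<open>c\<close> is the constant term.
\<close>

lemma trig_poly_antiderivative:
  "trig_poly q \<Longrightarrow> \<exists>c P. trig_poly P \<and> (\<forall>t. (P has_vector_derivative (q t - c)) (at t))"
proof (induction rule: trig_poly.induct)
  case (monom c k)
  show ?case
  proof (cases "k = 0")
    case True
    then show ?thesis
      by (intro exI[of _ c] exI[of _ "\<lambda>t. 0"]) (simp add: trig_poly_const)
  next
    case False
    then show ?thesis
      using has_vector_derivative_cis_mult[of "c / (\<i> * of_int k)" "of_int k"]
      by (intro exI[of _ 0] exI[of _ "\<lambda>t. c / (\<i> * of_int k) * cis (of_int k * t)"] conjI
          trig_poly.monom) simp
  qed
next
  case (add p q)
  then obtain c P d Q where "trig_poly P" "\<And>t. (P has_vector_derivative (p t - c)) (at t)"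
    "trig_poly Q" "\<And>t. (Q has_vector_derivative (q t - d)) (at t)" by blast
  moreover from this have "((\<lambda>t. P t + Q t) has_vector_derivative (p t - c + (q t - d))) (at t)" for t
    by (intro has_vector_derivative_add)
  ultimately show ?case
    by (intro exI[of _ "c + d"] exI[of _ "\<lambda>t. P t + Q t"])
      (auto intro: trig_poly.add simp: algebra_simps)
qed

text \<open>
  Near \<open>z0\<close> the map \<open>cis\<close> is inverted by a rotated branch of the argument that is continuous there,
  so continuity in the angle descends to the circle.
\<close>

lemma continuous_on_circle:
  fixes g :: "complex \<Rightarrow> complex"
  assumes "continuous_on UNIV (\<lambda>t. g (cis t))"
  shows "continuous_on (sphere 0 1) g"
  unfolding continuous_on_def
proof
  fix z0 :: complex assume "z0 \<in> sphere 0 1"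
  then have z0: "cmod z0 = 1" by simp
  define t0 where "t0 = Arg z0"
  have t0: "cis t0 = z0"
    using z0 cis_Arg[of z0] by (force simp: t0_def sgn_div_norm)
  define F where "F z = g (cis (t0 + Arg (z / z0)))" for z
  have eq: "F z = g z" if "z \<in> sphere 0 1" for z
  proof -
    have "z \<noteq> 0" "cmod z = 1" using that by auto
    moreover have "z0 \<noteq> 0" using z0 by auto
    ultimately have "cis (Arg (z / z0)) = z / z0"
      using z0 by (simp add: cis_Arg sgn_div_norm norm_divide)
    then show ?thesis
      using \<open>z0 \<noteq> 0\<close> by (simp add: F_def t0 cis_mult[symmetric])
  qed
  have Arg: "isCont Arg 1" by (rule continuous_at_Arg) simp
  have "z0 \<noteq> 0" using z0 by auto
  have "((\<lambda>z. z / z0) \<longlongrightarrow> z0 / z0) (at z0 within sphere 0 1)"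
    using \<open>z0 \<noteq> 0\<close> by (intro tendsto_intros)
  then have "((\<lambda>z. z / z0) \<longlongrightarrow> 1) (at z0 within sphere 0 1)"
    using \<open>z0 \<noteq> 0\<close> by simp
  from isCont_tendsto_compose[OF Arg this]
  have "((\<lambda>z. t0 + Arg (z / z0)) \<longlongrightarrow> t0 + Arg 1) (at z0 within sphere 0 1)"
    by (rule tendsto_add[OF tendsto_const])
  moreover have "isCont (\<lambda>t. g (cis t)) (t0 + Arg 1)"
    using assms by (simp add: continuous_on_eq_continuous_at)
  ultimately have "(F \<longlongrightarrow> F z0) (at z0 within sphere 0 1)"
    using isCont_tendsto_compose[of "t0 + Arg 1" "\<lambda>t. g (cis t)"] \<open>z0 \<noteq> 0\<close>
    by (simp add: F_def[abs_def])
  moreover have "eventually (\<lambda>z. F z = g z) (at z0 within sphere 0 1)"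
    using eq by (auto simp: eventually_at_filter)
  ultimately show "(g \<longlongrightarrow> g z0) (at z0 within sphere 0 1)"
    using eq[OF \<open>z0 \<in> sphere 0 1\<close>] by (simp add: tendsto_cong)
qed

text \<open>
  On the circle, polynomials in the two real coordinates are trigonometric polynomials, because the
  coordinates are \<open>(cis t + cis (- t)) / 2\<close> and \<open>(cis t - cis (- t)) / (2 * \<i>)\<close>. This turns the
  Stone--Weierstrass theorem into Weierstrass's theorem on trigonometric approximation.
\<close>

lemma trig_poly_real_polynomial:
  "real_polynomial_function f \<Longrightarrow> trig_poly (\<lambda>t. complex_of_real (f (cis t)))"
proof (induction rule: real_polynomial_function.induct)
  case (linear f)
  interpret f: bounded_linear f by fact
  have "f (cis t) = cos t * f 1 + sin t * f \<i>" for t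
  proof -
    have "cis t = cos t *\<^sub>R 1 + sin t *\<^sub>R \<i>"
      by (simp add: complex_eq_iff)
    then show ?thesis by (metis f.add f.scaleR real_scaleR_def)
  qed
  then have "complex_of_real (f (cis t)) = (f 1 - \<i> * f \<i>) / 2 * cis (of_int 1 * t)
      + (f 1 + \<i> * f \<i>) / 2 * cis (of_int (-1) * t)" for t
    by (simp add: complex_eq_iff field_simps)
  then show ?case
    by (simp only:) (intro trig_poly.add trig_poly.monom)
next
  case (const c)
  then show ?case by (rule trig_poly_const)
next
  case (add f g)
  then show ?case using trig_poly.add[OF add.IH] by simp
next
  case (mult f g)
  then show ?case using trig_poly_mult[OF mult.IH] by simp
qed

lemma periodic_int:
  fixes h :: "real \<Rightarrow> 'a"
  assumes "\<And>t. h (t + 2 * pi) = h t"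
  shows "h (t + 2 * pi * of_int n) = h t"
proof (induction n rule: int_induct[where k = 0])
  case base
  then show ?case by simp
next
  case (step1 i)
  then show ?case using assms[of "t + 2 * pi * of_int i"] by (simp add: algebra_simps)
next
  case (step2 i)
  then show ?case using assms[of "t + 2 * pi * of_int (i - 1)"] by (simp add: algebra_simps)
qed

lemma trig_poly_dense_continuous:
  assumes "continuous_on UNIV h" and per: "\<And>t. h (t + 2 * pi) = h t" and "\<epsilon> > 0"
  shows "\<exists>p. trig_poly p \<and> (\<forall>t. norm (h t - p t) \<le> \<epsilon>)"
proof -
  define g where "g z = h (Arg z)" for z
  have g: "g (cis t) = h t" for t
  proof -
    have "cis (Arg (cis t)) = cis t" by (simp add: cis_Arg)
    then obtain n :: int where "Arg (cis t) = t + 2 * pi * of_int n"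
      by (auto simp: complex_eq_iff) (metis sin_cos_eq_iff)
    then show ?thesis
      using periodic_int[of h t n] per by (simp add: g_def)
  qed
  have "continuous_on (sphere 0 1) g"
    by (rule continuous_on_circle) (simp add: g assms(1))
  then obtain f where f: "polynomial_function f" "\<And>z. z \<in> sphere 0 1 \<Longrightarrow> norm (g z - f z) < \<epsilon>"
    using Stone_Weierstrass_polynomial_function[of "sphere 0 1" g \<epsilon>] assms(3) by auto
  have "real_polynomial_function (Re \<circ> f)" "real_polynomial_function (Im \<circ> f)"
    using f(1) by (simp_all add: polynomial_function_def bounded_linear_Re bounded_linear_Im)
  then have "trig_poly (\<lambda>t. complex_of_real ((Re \<circ> f) (cis t)) + \<i> * complex_of_real ((Im \<circ> f) (cis t)))"
    by (intro trig_poly.add trig_poly_mult[OF trig_poly_const] trig_poly_real_polynomial)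
  moreover have "norm (h t - (complex_of_real ((Re \<circ> f) (cis t)) + \<i> * complex_of_real ((Im \<circ> f) (cis t)))) \<le> \<epsilon>" for t
    using f(2)[of "cis t"] by (simp add: g complex_eq[symmetric])
  ultimately show ?thesis by (intro exI conjI allI)
qed

lemma norm_diff_le_vector_derivative:
  fixes f :: "real \<Rightarrow> complex"
  assumes der: "\<And>t. (f has_vector_derivative f' t) (at t)" and bound: "\<And>t. norm (f' t) \<le> B" and "a \<le> b"
  shows "norm (f b - f a) \<le> B * (b - a)"
proof (cases "a = b")
  case False
  then have "a < b" using assms by simp
  have "continuous_on {a..b} f"
    using der by (meson continuous_at_imp_continuous_on has_vector_derivative_continuous)
  from mvt_general[OF \<open>a < b\<close> this, of "\<lambda>t x. x *\<^sub>R f' t"] der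
  obtain t where "norm (f b - f a) \<le> norm ((b - a) *\<^sub>R f' t)"
    by (auto simp: has_vector_derivative_def)
  also have "\<dots> \<le> (b - a) * B"
    using \<open>a < b\<close> bound by (simp add: mult_left_mono)
  finally show ?thesis by (simp add: mult.commute)
qed simp

text \<open>
  Density in the \<open>C\<close>-\<open>N\<close> norm by integration instead of Fourier series: approximate \<open>h'\<close> by \<open>q\<close>
  and integrate. The antiderivative of \<open>q\<close> is periodic only once its mean value \<open>c\<close> has been
  removed, and \<open>c\<close> is small because \<open>h'\<close> has mean value zero.
\<close>

lemma trig_poly_dense_smooth:
  assumes "smooth_real h" and "\<And>t. h (t + 2 * pi) = h t" and "\<epsilon> > 0"
  shows "\<exists>p. trig_poly p \<and> (\<forall>j\<le>N. \<forall>t. norm ((vd ^^ j) (\<lambda>t. h t - p t) t) \<le> \<epsilon>)"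
  using assms
proof (induction N arbitrary: h \<epsilon>)
  case 0
  then show ?case
    using trig_poly_dense_continuous[OF smooth_real_continuous] by simp
next
  case (Suc N)
  note smooth = \<open>smooth_real h\<close> and per = \<open>\<And>t. h (t + 2 * pi) = h t\<close>
  have der: "(h has_vector_derivative vd h t) (at t)" for t
    using smooth by (rule smooth_real_has_vd)
  have per': "vd h (t + 2 * pi) = vd h t" for t
  proof -
    have "((\<lambda>t. h (t + 2 * pi)) has_vector_derivative (1 *\<^sub>R vd h (t + 2 * pi))) (at t)"
      using vector_diff_chain_at[of "\<lambda>t. t + 2 * pi" 1 t h] der[of "t + 2 * pi"]
      by (simp add: o_def has_vector_derivative_add_const)
    then show ?thesis
      using per der[of t] by (simp add: vector_derivative_at)
  qed
  define \<delta> where "\<delta> = \<epsilon> / (4 * pi)"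
  have \<delta>: "\<delta> > 0" "2 * \<delta> \<le> \<epsilon>" "2 * \<delta> * (2 * pi) = \<epsilon>"
    using Suc.prems(3) pi_gt3 by (simp_all add: \<delta>_def field_simps)
  obtain q where q: "trig_poly q" "\<And>j t. j \<le> N \<Longrightarrow> norm ((vd ^^ j) (\<lambda>t. vd h t - q t) t) \<le> \<delta>"
    using Suc.IH[OF smooth_real_vd[OF smooth] per' \<delta>(1)] by blast
  obtain c P where P: "trig_poly P" "\<And>t. (P has_vector_derivative (q t - c)) (at t)"
    using trig_poly_antiderivative[OF q(1)] by blast
  \<comment> \<open>\<open>h - P\<close> is periodic, so over a period the linear term is the only one that changes\<close>
  have c: "norm c \<le> \<delta>"
  proof -
    define r where "r t = h t - P t - c * of_real t" for t
    have "(r has_vector_derivative (vd h t - (q t - c) - c * 1)) (at t)" for t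
      unfolding r_def
      by (intro has_vector_derivative_diff der P has_vector_derivative_mult_right)
        (rule has_vector_derivative_real_field[where f = "\<lambda>x. x" and f' = "1 :: complex"], simp)
    then have "(r has_vector_derivative (vd h t - q t)) (at t)" for t
      by simp
    then have "norm (r (2 * pi) - r 0) \<le> \<delta> * (2 * pi - 0)"
      using q(2)[of 0] by (intro norm_diff_le_vector_derivative) auto
    moreover have "r (2 * pi) - r 0 = - (c * of_real (2 * pi))"
      using per[of 0] trig_poly_periodic[OF P(1), of 0] by (simp add: r_def)
    ultimately have "norm c * (2 * pi) \<le> \<delta> * (2 * pi)"
      by (simp add: norm_mult)
    then show ?thesis by simp
  qed
  define p where "p t = P t + (h 0 - P 0)" for t
  have p: "trig_poly p"
    unfolding p_def by (intro trig_poly.add P trig_poly_const)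
  have der_s: "((\<lambda>t. h t - p t) has_vector_derivative (vd h t - q t + c)) (at t)" for t
  proof -
    have "((\<lambda>t. h t - p t) has_vector_derivative (vd h t - ((q t - c) + 0))) (at t)"
      unfolding p_def
      by (intro has_vector_derivative_diff der has_vector_derivative_add P has_vector_derivative_const)
    also have "vd h t - ((q t - c) + 0) = vd h t - q t + c" by simp
    finally show ?thesis .
  qed
  have bound: "norm (vd h t - q t + c) \<le> 2 * \<delta>" for t
    using norm_triangle_ineq[of "vd h t - q t" c] q(2)[of 0 t] c by simp
  have "norm ((vd ^^ j) (\<lambda>t. h t - p t) t) \<le> \<epsilon>" if "j \<le> Suc N" for j t
  proof (cases j)
    case 0
    define u where "u = t + 2 * pi * of_int (- \<lfloor>t / (2 * pi)\<rfloor>)"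
    have u: "0 \<le> u" "u \<le> 2 * pi"
    proof -
      define n where "n = \<lfloor>t / (2 * pi)\<rfloor>"
      have "of_int n \<le> t / (2 * pi)" "t / (2 * pi) \<le> of_int n + 1"
        unfolding n_def by linarith+
      then have "of_int n * (2 * pi) \<le> t" "t \<le> (of_int n + 1) * (2 * pi)"
        by (simp_all add: pos_le_divide_eq pos_divide_le_eq)
      then show "0 \<le> u" "u \<le> 2 * pi"
        by (simp_all add: u_def n_def algebra_simps)
    qed
    have "h t - p t = h u - p u"
      unfolding u_def using per trig_poly_periodic[OF p]
      by (subst periodic_int[of "\<lambda>t. h t - p t"]) auto
    moreover have "h 0 - p 0 = 0" by (simp add: p_def)
    ultimately have "norm (h t - p t) = norm ((h u - p u) - (h 0 - p 0))"
      by simp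
    also have "\<dots> \<le> 2 * \<delta> * (u - 0)"
      using u bound der_s by (intro norm_diff_le_vector_derivative[of "\<lambda>t. h t - p t"]) auto
    also have "\<dots> \<le> 2 * \<delta> * (2 * pi)"
      using u \<delta>(1) by (intro mult_left_mono) auto
    finally show ?thesis using 0 \<delta>(3) by simp
  next
    case (Suc i)
    have "vd (\<lambda>t. h t - p t) = (\<lambda>t. (vd h t - q t) + c)"
      using vector_derivative_at[OF der_s] by simp
    then have "(vd ^^ j) (\<lambda>t. h t - p t) = (vd ^^ i) (\<lambda>t. (vd h t - q t) + c)"
      unfolding Suc funpow_Suc_right by simp
    also have "\<dots> = (\<lambda>t. (vd ^^ i) (\<lambda>t. vd h t - q t) t + (if i = 0 then c else 0))"
      using vd_funpow_add[OF smooth_real_diff[OF smooth_real_vd[OF smooth] smooth_real_trig_poly[OF q(1)]]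
          smooth_real_const[of c], of i]
      by (simp add: vd_funpow_const)
    finally have "norm ((vd ^^ j) (\<lambda>t. h t - p t) t) \<le> norm ((vd ^^ i) (\<lambda>t. vd h t - q t) t) + norm c"
      by (auto intro: norm_triangle_ineq)
    then show ?thesis
      using q(2)[of i t] c \<delta>(2) that Suc by simp
  qed
  then show ?case using p by blast
qed

section \<open>The Herglotz theorem\<close>

text \<open>
  Membership in \<open>\<real>\<^sub>\<ge>\<^sub>0\<close> contains the reality of the Toeplitz form, and thereby the symmetry
  \<open>c (- k) = cnj (c k)\<close>.
\<close>

definition positive_definite_seq :: "(int \<Rightarrow> complex) \<Rightarrow> bool" where
  "positive_definite_seq c \<longleftrightarrow>
    (\<forall>N a. (\<Sum>j\<le>N. \<Sum>l\<le>N. a j * cnj (a l) * c (int j - int l)) \<in> \<real>\<^sub>\<ge>\<^sub>0)"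

text \<open>
  The number of entries on the \<open>k\<close>-th diagonal of a square matrix of size \<open>N + 1\<close>; this is where the
  Fejer weights \<open>(N + 1 - \<bar>k\<bar>) / (N + 1)\<close> come from.
\<close>

lemma sum_diff_eq:
  assumes "\<bar>k\<bar> \<le> int N"
  shows "(\<Sum>j\<le>N. \<Sum>l\<le>N. if int j - int l = k then x else 0)
    = (of_nat (N + 1 - nat \<bar>k\<bar>) * x :: complex)"
proof -
  let ?S = "{(j, l). j \<le> N \<and> l \<le> N \<and> int j - int l = k}"
  have "bij_betw (\<lambda>i. (i + nat k, i + nat (- k))) {..N - nat \<bar>k\<bar>} ?S"
  proof (rule bij_betwI[where g = "\<lambda>(j, l). min j l"])
    show "(\<lambda>i. (i + nat k, i + nat (- k))) \<in> {..N - nat \<bar>k\<bar>} \<rightarrow> ?S"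
      using assms by auto
    show "(\<lambda>(j, l). min j l) \<in> ?S \<rightarrow> {..N - nat \<bar>k\<bar>}"
      by (auto simp: min_def)
  qed (auto simp: min_def)
  then have card: "card ?S = N + 1 - nat \<bar>k\<bar>"
    using assms by (auto simp: bij_betw_same_card[symmetric])
  have "(\<Sum>j\<le>N. \<Sum>l\<le>N. if int j - int l = k then x else 0)
      = (\<Sum>(j, l)\<in>{..N} \<times> {..N}. if int j - int l = k then x else 0)"
    by (simp add: sum.cartesian_product)
  also have "\<dots> = (\<Sum>p\<in>?S. x)"
    by (rule sum.mono_neutral_cong_right) (auto split: if_splits)
  also have "\<dots> = of_nat (card ?S) * x" by simp
  finally show ?thesis unfolding card .
qed

definition circle_integral :: "(real \<Rightarrow> complex) \<Rightarrow> complex" where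
  "circle_integral f = integral\<^sup>L lborel (\<lambda>t. indicator {0..2*pi} t *\<^sub>R f t)"

lemma circle_integrable:
  fixes f :: "real \<Rightarrow> 'a::{banach, second_countable_topology}"
  shows "continuous_on UNIV f \<Longrightarrow> integrable lborel (\<lambda>t. indicator {0..2*pi} t *\<^sub>R f t)"
  by (rule borel_integrable_compact) (auto intro: continuous_on_subset)

lemma circle_integral_cis:
  fixes c :: complex
  shows "circle_integral (\<lambda>t. c * cis (of_int k * t)) = (if k = 0 then 2 * pi * c else 0)"
proof (cases "k = 0")
  case True
  have "circle_integral (\<lambda>t. c * cis (of_int k * t)) = (2 * pi) *\<^sub>R c - 0 *\<^sub>R c"
    unfolding circle_integral_def using True
    by (intro integral_FTC_atLeastAtMost) (auto intro!: derivative_eq_intros continuous_intros)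
  then show ?thesis using True by (simp add: scaleR_conv_of_real)
next
  case False
  let ?F = "\<lambda>t. c / (\<i> * of_int k) * cis (of_int k * t)"
  have "circle_integral (\<lambda>t. c * cis (of_int k * t)) = ?F (2 * pi) - ?F 0"
    unfolding circle_integral_def
  proof (rule integral_FTC_atLeastAtMost)
    fix t
    show "(?F has_vector_derivative c * cis (of_int k * t)) (at t within {0..2 * pi})"
      using has_vector_derivative_at_within[OF has_vector_derivative_cis_mult[of "c / (\<i> * of_int k)" "of_int k" t]] False
      by simp
  qed (auto intro!: continuous_intros)
  also have "cis (of_int k * (2 * pi)) = 1"
    using cis_multiple_2pi[of "of_int k"] by (simp add: mult.commute)
  finally show ?thesis using False by simp
qed

text \<open>
  \<open>N + 1\<close> times the Fejer mean of the formal series \<open>\<Sum>k. c k * cis (- k * t)\<close>, so that \<open>c k\<close> is recovered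
  by integration against \<open>cis (k * t)\<close>. As a double sum it is the Toeplitz form of \<open>c\<close> at the vector
  \<open>j \<mapsto> cis (- j * t)\<close>, hence nonnegative for positive definite \<open>c\<close>.
\<close>

definition Fejer_density :: "(int \<Rightarrow> complex) \<Rightarrow> nat \<Rightarrow> real \<Rightarrow> complex" where
  "Fejer_density c N t = (\<Sum>j\<le>N. \<Sum>l\<le>N. c (int j - int l) * cis (of_int (int l - int j) * t))"

lemma Fejer_density_nonneg:
  fixes c :: "int \<Rightarrow> complex"
  assumes "positive_definite_seq c"
  shows "Fejer_density c N t \<in> \<real>\<^sub>\<ge>\<^sub>0"
proof -
  have "(\<Sum>j\<le>N. \<Sum>l\<le>N. cis (- (real j * t)) * cnj (cis (- (real l * t))) * c (int j - int l)) \<in> \<real>\<^sub>\<ge>\<^sub>0"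
    using assms[unfolded positive_definite_seq_def, rule_format,
        where N = N and a = "\<lambda>j. cis (- (real j * t))"] .
  also have "(\<Sum>j\<le>N. \<Sum>l\<le>N. cis (- (real j * t)) * cnj (cis (- (real l * t))) * c (int j - int l)) = Fejer_density c N t"
    unfolding Fejer_density_def by (intro sum.cong refl) (simp add: cis_cnj cis_mult algebra_simps)
  finally show ?thesis .
qed

lemma continuous_Fejer_density: "continuous_on A (Fejer_density c N)"
  unfolding Fejer_density_def[abs_def] by (intro continuous_intros)

lemma circle_integral_Fejer_density:
  fixes c :: "int \<Rightarrow> complex"
  assumes "\<bar>k\<bar> \<le> int N"
  shows "circle_integral (\<lambda>t. Fejer_density c N t * cis (of_int k * t))
    = 2 * pi * of_nat (N + 1 - nat \<bar>k\<bar>) * c k"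
proof -
  have "circle_integral (\<lambda>t. Fejer_density c N t * cis (of_int k * t))
      = circle_integral (\<lambda>t. \<Sum>j\<le>N. \<Sum>l\<le>N. c (int j - int l) * cis (of_int (k + int l - int j) * t))"
  proof -
    have "Fejer_density c N t * cis (of_int k * t)
        = (\<Sum>j\<le>N. \<Sum>l\<le>N. c (int j - int l) * cis (of_int (k + int l - int j) * t))" for t
      unfolding Fejer_density_def sum_distrib_right mult.assoc cis_mult
      by (intro sum.cong refl arg_cong2[of _ _ _ _ "(*)"] arg_cong[of _ _ cis]) (simp add: algebra_simps)
    then show ?thesis by simp
  qed
  also have "\<dots> = (\<Sum>j\<le>N. \<Sum>l\<le>N. circle_integral (\<lambda>t. c (int j - int l) * cis (of_int (k + int l - int j) * t)))"
  proof -
    have int: "integrable lborel (\<lambda>t. indicator {0..2*pi} t *\<^sub>R (c (int j - int l) * cis (of_int (k + int l - int j) * t)))" for j l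
      by (intro circle_integrable continuous_intros)
    show ?thesis
      unfolding circle_integral_def scaleR_sum_right
      by (simp only: Bochner_Integration.integral_sum Bochner_Integration.integrable_sum int)
  qed
  also have "\<dots> = (\<Sum>j\<le>N. \<Sum>l\<le>N. if int j - int l = k then 2 * pi * c k else 0)"
    unfolding circle_integral_cis by (intro sum.cong refl) auto
  also have "\<dots> = of_nat (N + 1 - nat \<bar>k\<bar>) * (2 * pi * c k)"
    by (rule sum_diff_eq[OF assms])
  finally show ?thesis by (simp add: mult_ac)
qed

lemma positive_definite_seq_0:
  fixes c :: "int \<Rightarrow> complex"
  assumes "positive_definite_seq c"
  shows "c 0 \<in> \<real>\<^sub>\<ge>\<^sub>0"
  using assms[unfolded positive_definite_seq_def, rule_format, where N = 0 and a = "\<lambda>_. 1"] by simp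

text \<open>
  The degenerate case of the Herglotz theorem, in which the Fejer densities cannot be normalised to
  probability densities.
\<close>

lemma positive_definite_seq_eq_0:
  fixes c :: "int \<Rightarrow> complex"
  assumes "positive_definite_seq c" "c 0 = 0"
  shows "c k = 0"
proof -
  define N where "N = nat \<bar>k\<bar>"
  let ?f = "\<lambda>t. indicator {0..2*pi} t *\<^sub>R (Fejer_density c N t * cis (of_int k * t))"
  have nonneg: "Fejer_density c N t = of_real (cmod (Fejer_density c N t))" for t
    using Fejer_density_nonneg[OF assms(1), of N t] by (auto simp: nonneg_Reals_def)
  let ?I = "\<integral>t. indicator {0..2*pi} t *\<^sub>R cmod (Fejer_density c N t) \<partial>lborel"
  have "complex_of_real ?I = (\<integral>t. complex_of_real (indicator {0..2*pi} t *\<^sub>R cmod (Fejer_density c N t)) \<partial>lborel)"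
    by (rule integral_complex_of_real[symmetric])
  also have "\<dots> = circle_integral (\<lambda>t. Fejer_density c N t * cis (of_int 0 * t))"
    unfolding circle_integral_def using nonneg by (simp add: scaleR_conv_of_real)
  also have "\<dots> = 0"
    by (subst circle_integral_Fejer_density) (simp_all add: assms)
  finally have "?I = 0" by simp
  moreover have "norm (circle_integral (\<lambda>t. Fejer_density c N t * cis (of_int k * t)))
      \<le> (\<integral>t. norm (?f t) \<partial>lborel)"
    unfolding circle_integral_def by (rule integral_norm_bound)
  moreover have "(\<integral>t. norm (?f t) \<partial>lborel) = ?I"
    by (simp add: norm_mult)
  ultimately have "circle_integral (\<lambda>t. Fejer_density c N t * cis (of_int k * t)) = 0"
    by simp
  then show ?thesis
    using circle_integral_Fejer_density[of k N c] by (simp add: N_def)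
qed

text \<open>
  The normalised Fejer densities are probability densities carried by one compact interval, and
  their integral against \<open>cis (k * t)\<close> is \<open>c k / c 0\<close> up to a factor that tends to \<open>1\<close>. Tightness yields
  a weak limit along a subsequence, for which these integrals are exactly \<open>c k / c 0\<close>.
\<close>

lemma Herglotz_interval:
  fixes c :: "int \<Rightarrow> complex"
  assumes pd: "positive_definite_seq c"
  shows "\<exists>M. real_distribution M \<and> (\<forall>k. c 0 * (\<integral>t. cis (of_int k * t) \<partial>M) = c k)"
proof (cases "c 0 = 0")
  case True
  \<comment> \<open>any distribution serves here: all coefficients vanish\<close>
  have "real_distribution (uniform_measure lborel {0..1})"
    by (auto simp: real_distribution_def real_distribution_axioms_def
        intro!: prob_space_uniform_measure)
  then show ?thesis
    using positive_definite_seq_eq_0[OF pd True] True by auto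
next
  case False
  define c0 where "c0 = Re (c 0)"
  have c0: "c 0 = of_real c0" "c0 > 0"
    using positive_definite_seq_0[OF pd] False by (auto simp: c0_def nonneg_Reals_def)
  define w where "w N t = indicator {0..2*pi} t *\<^sub>R (Re (Fejer_density c N t) / (2 * pi * (N + 1) * c0))" for N t
  have w_nonneg: "w N t \<ge> 0" for N t
    using Fejer_density_nonneg[OF pd, of N t] c0(2)
    by (auto simp: w_def nonneg_Reals_def intro!: mult_nonneg_nonneg divide_nonneg_nonneg)
  have w_int: "integrable lborel (w N)" for N
    unfolding w_def[abs_def] using c0(2)
    by (intro circle_integrable continuous_intros continuous_Fejer_density) auto
  have w_meas [measurable]: "w N \<in> borel_measurable borel" for N
    using w_int[of N] by (auto dest: borel_measurable_integrable)
  have w_cis: "(\<integral>t. w N t *\<^sub>R cis (of_int k * t) \<partial>lborel) = of_nat (N + 1 - nat \<bar>k\<bar>) / of_nat (N + 1) * (c k / c0)"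
    if "\<bar>k\<bar> \<le> int N" for N k
  proof -
    have Re: "Fejer_density c N t = of_real (Re (Fejer_density c N t))" for t
      using Fejer_density_nonneg[OF pd, of N t] by (auto simp: nonneg_Reals_def)
    have "w N t *\<^sub>R cis (of_int k * t) = (1 / (2 * pi * (N + 1) * c0)) *\<^sub>R
        (indicator {0..2*pi} t *\<^sub>R (Fejer_density c N t * cis (of_int k * t)))" for t
      by (subst Re) (simp add: w_def scaleR_conv_of_real)
    then have "(\<integral>t. w N t *\<^sub>R cis (of_int k * t) \<partial>lborel) = (1 / (2 * pi * (N + 1) * c0)) *\<^sub>R
        circle_integral (\<lambda>t. Fejer_density c N t * cis (of_int k * t))"
      by (simp only: circle_integral_def integral_scaleR_right)
    also have "\<dots> = of_nat (N + 1 - nat \<bar>k\<bar>) / of_nat (N + 1) * (c k / c0)"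
      unfolding circle_integral_Fejer_density[OF that] by (simp add: scaleR_conv_of_real)
    finally show ?thesis .
  qed
  have w_1: "(\<integral>t. w N t \<partial>lborel) = 1" for N
  proof -
    have "complex_of_real (\<integral>t. w N t \<partial>lborel) = (\<integral>t. w N t *\<^sub>R cis (of_int 0 * t) \<partial>lborel)"
      by (simp add: scaleR_conv_of_real)
    also have "\<dots> = 1"
      using c0 by (subst w_cis) (simp_all del: of_nat_Suc)
    finally show ?thesis by simp
  qed
  define \<mu> where "\<mu> N = density lborel (\<lambda>t. ennreal (w N t))" for N
  have emeasure_\<mu>: "emeasure (\<mu> N) A = 1" if [measurable]: "A \<in> sets borel" and "{0..2*pi} \<subseteq> A" for N A
  proof -
    have "emeasure (\<mu> N) A = (\<integral>\<^sup>+t. ennreal (w N t) * indicator A t \<partial>lborel)"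
      unfolding \<mu>_def by (rule emeasure_density) (auto simp: that)
    also have "\<dots> = (\<integral>\<^sup>+t. ennreal (w N t) \<partial>lborel)"
      using that(2) by (intro nn_integral_cong) (auto simp: w_def indicator_def)
    also have "\<dots> = ennreal (\<integral>t. w N t \<partial>lborel)"
      using w_int w_nonneg by (intro nn_integral_eq_integral) auto
    finally show ?thesis by (simp add: w_1)
  qed
  have \<mu>: "real_distribution (\<mu> N)" for N
    unfolding real_distribution_def real_distribution_axioms_def
  proof
    show "prob_space (\<mu> N)"
      by (rule prob_spaceI, rule emeasure_\<mu>) (auto simp: \<mu>_def)
  qed (simp add: \<mu>_def)
  have "tight \<mu>"
    unfolding tight_def
  proof (intro conjI allI impI \<mu>)
    fix \<epsilon> :: real assume "\<epsilon> > 0"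
    have "measure (\<mu> n) {-1<..2 * pi} = 1" for n
      by (subst measure_def, subst emeasure_\<mu>) auto
    moreover have "-1 < 2 * pi" using pi_gt_zero by linarith
    ultimately show "\<exists>a b. a < b \<and> (\<forall>n. 1 - \<epsilon> < measure (\<mu> n) {a<..b})"
      using \<open>\<epsilon> > 0\<close> by (intro exI[of _ "-1"] exI[of _ "2 * pi"]) simp
  qed
  then obtain r M where r: "strict_mono (r :: nat \<Rightarrow> nat)" and M: "real_distribution M"
    and conv: "weak_conv_m (\<mu> \<circ> id \<circ> r) M"
    using tight_imp_convergent_subsubsequence[OF _ strict_mono_id] by blast
  have "c 0 * (\<integral>t. cis (of_int k * t) \<partial>M) = c k" for k
  proof -
    have cont: "continuous_on UNIV (\<lambda>t. cis (of_int k * t))"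
      by (intro continuous_intros)
    have "(\<lambda>n. integral\<^sup>L ((\<mu> \<circ> id \<circ> r) n) (\<lambda>t. cis (of_int k * t))) \<longlonglongrightarrow> (\<integral>t. cis (of_int k * t) \<partial>M)"
      by (rule weak_conv_imp_integral_bdd_continuous_conv[OF _ M conv, where B = 1])
        (use cont in \<open>auto simp: continuous_on_eq_continuous_at intro: \<mu>\<close>)
    moreover have "eventually (\<lambda>n. integral\<^sup>L ((\<mu> \<circ> id \<circ> r) n) (\<lambda>t. cis (of_int k * t))
        = of_nat (r n + 1 - nat \<bar>k\<bar>) / of_nat (r n + 1) * (c k / c0)) sequentially"
      using eventually_ge_at_top[of "nat \<bar>k\<bar>"]
    proof eventually_elim
      case (elim n)
      then have "\<bar>k\<bar> \<le> int (r n)" using seq_suble[OF r, of n] by linarith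
      from w_cis[OF this] show ?case
        by (simp add: \<mu>_def integral_density w_nonneg borel_measurable_continuous_onI[OF cont])
    qed
    ultimately have "(\<lambda>n. of_nat (r n + 1 - nat \<bar>k\<bar>) / of_nat (r n + 1) * (c k / c0)) \<longlonglongrightarrow> (\<integral>t. cis (of_int k * t) \<partial>M)"
      by (simp add: tendsto_cong)
    moreover have "(\<lambda>n. of_nat (r n + 1 - nat \<bar>k\<bar>) / of_nat (r n + 1) * (c k / c0)) \<longlonglongrightarrow> 1 * (c k / c0)"
    proof (intro tendsto_mult tendsto_const)
      have "(\<lambda>n. 1 - of_nat (nat \<bar>k\<bar>) * (1 / complex_of_nat (Suc n))) \<longlonglongrightarrow> 1 - of_nat (nat \<bar>k\<bar>) * 0"
        by (intro tendsto_intros LIMSEQ_Suc lim_1_over_n)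
      moreover have "eventually (\<lambda>n. 1 - of_nat (nat \<bar>k\<bar>) * (1 / complex_of_nat (Suc n))
          = of_nat (n + 1 - nat \<bar>k\<bar>) / of_nat (n + 1)) sequentially"
        using eventually_ge_at_top[of "nat \<bar>k\<bar>"]
        by eventually_elim (simp add: of_nat_diff divide_simps del: of_nat_Suc)
      ultimately have "(\<lambda>n. of_nat (n + 1 - nat \<bar>k\<bar>) / complex_of_nat (n + 1)) \<longlonglongrightarrow> 1"
        by (simp add: tendsto_cong)
      from LIMSEQ_subseq_LIMSEQ[OF this r]
      show "(\<lambda>n. of_nat (r n + 1 - nat \<bar>k\<bar>) / complex_of_nat (r n + 1)) \<longlonglongrightarrow> 1"
        by (simp add: o_def)
    qed
    ultimately have "(\<integral>t. cis (of_int k * t) \<partial>M) = 1 * (c k / c0)"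
      by (rule LIMSEQ_unique)
    then show ?thesis using c0 by simp
  qed
  with M show ?thesis by blast
qed

definition circle_measure :: "complex measure \<Rightarrow> bool" where
  "circle_measure M \<longleftrightarrow> finite_measure M \<and> space M = sphere 0 1 \<and>
    sets M = sets (restrict_space borel (sphere 0 1))"

text \<open>
  The measure on the interval is scaled by \<open>c 0\<close> and wrapped around the circle by \<open>cis\<close>.
\<close>

theorem Herglotz:
  fixes c :: "int \<Rightarrow> complex"
  assumes pd: "positive_definite_seq c"
  shows "\<exists>M. circle_measure M \<and> (\<forall>k. (LINT z|M. z powi k) = c k)"
proof -
  obtain M' where M': "real_distribution M'" "\<And>k. c 0 * (\<integral>t. cis (of_int k * t) \<partial>M') = c k"
    using Herglotz_interval[OF pd] by blast
  interpret M': real_distribution M' by fact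
  define c0 where "c0 = Re (c 0)"
  have c0: "c 0 = of_real c0" "c0 \<ge> 0"
    using positive_definite_seq_0[OF pd] by (auto simp: c0_def nonneg_Reals_def)
  let ?B = "restrict_space borel (sphere (0::complex) 1)"
  define D where "D = density M' (\<lambda>_. ennreal c0)"
  have fin: "finite_measure D"
    by (rule finite_measureI) (simp add: D_def emeasure_density M'.emeasure_space_1 ennreal_mult_eq_top_iff)
  have cis: "cis \<in> measurable D ?B"
    by (intro measurable_restrict_space2) (auto simp: D_def borel_measurable_continuous_onI continuous_on_cis)
  have "(LINT z|distr D ?B cis. z powi k) = c k" for k
  proof -
    have "(LINT z|distr D ?B cis. z powi k) = (LINT t|D. cis t powi k)"
      by (intro integral_distr cis borel_measurable_continuous_on_restrict continuous_intros) auto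
    also have "\<dots> = (LINT t|M'. c0 *\<^sub>R cis (of_int k * t))"
      unfolding D_def cis_power_int
      by (rule integral_density)
        (auto intro!: M'.measurable_finite_borel borel_measurable_continuous_onI continuous_intros
          simp: c0)
    also have "\<dots> = c k"
      using M'(2)[of k] c0 by (simp add: scaleR_conv_of_real)
    finally show ?thesis .
  qed
  moreover have "finite_measure (distr D ?B cis)"
    by (rule finite_measure.finite_measure_distr[OF fin cis])
  ultimately show ?thesis
    by (intro exI[of _ "distr D ?B cis"]) (auto simp: circle_measure_def space_restrict_space)
qed

section \<open>Distributions represented by measures\<close>

lemma measurable_circle_measure:
  fixes g :: "complex \<Rightarrow> complex"
  assumes "circle_measure M" "continuous_on (sphere 0 1) g"
  shows "g \<in> borel_measurable M"
proof -
  have "g \<in> borel_measurable (restrict_space borel (sphere 0 1))"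
    by (rule borel_measurable_continuous_on_restrict[OF assms(2)])
  then show ?thesis
    using assms(1) measurable_cong_sets[of M "restrict_space borel (sphere 0 1)" borel "borel :: complex measure"]
    by (simp add: circle_measure_def)
qed

lemma integrable_circle_measure:
  fixes g :: "complex \<Rightarrow> complex"
  assumes M: "circle_measure M" and g: "continuous_on (sphere 0 1) g"
  shows "integrable M g"
proof -
  interpret finite_measure M using M by (simp add: circle_measure_def)
  have "bounded (g ` sphere 0 1)"
    by (intro compact_imp_bounded compact_continuous_image g compact_sphere)
  then obtain B where "\<And>z. z \<in> sphere 0 1 \<Longrightarrow> norm (g z) \<le> B"
    unfolding bounded_iff by blast
  then show ?thesis
    using M by (intro integrable_const_bound[of _ B] measurable_circle_measure[OF M g])
      (auto simp: circle_measure_def)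
qed

lemma smooth_on_circle_continuous: "smooth_on_circle g \<Longrightarrow> continuous_on (sphere 0 1) g"
  by (simp add: continuous_on_circle smooth_on_circle_iff smooth_real_continuous)

lemma smooth_on_circle_powi: "smooth_on_circle (\<lambda>z. z powi k)"
  using smooth_real_cis[of 1 "of_int k"] by (simp add: smooth_on_circle_iff cis_power_int)

lemma continuous_on_circle_powi: "continuous_on (sphere 0 1) (\<lambda>z::complex. z powi k)"
  by (rule smooth_on_circle_continuous[OF smooth_on_circle_powi])

lemma smooth_on_circle_add:
  "smooth_on_circle g \<Longrightarrow> smooth_on_circle h \<Longrightarrow> smooth_on_circle (\<lambda>z. g z + h z)"
  by (simp add: smooth_on_circle_iff smooth_real_add)

lemma smooth_on_circle_cmult: "smooth_on_circle g \<Longrightarrow> smooth_on_circle (\<lambda>z. c * g z)"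
  by (simp add: smooth_on_circle_iff smooth_real_cmult)

lemma distribution_add:
  "distribution \<mu> \<Longrightarrow> smooth_on_circle g \<Longrightarrow> smooth_on_circle h \<Longrightarrow> \<mu> (\<lambda>z. g z + h z) = \<mu> g + \<mu> h"
  by (simp add: distribution_def)

lemma distribution_cmult:
  "distribution \<mu> \<Longrightarrow> smooth_on_circle g \<Longrightarrow> \<mu> (\<lambda>z. c * g z) = c * \<mu> g"
  by (simp add: distribution_def)

text \<open>
  A trigonometric polynomial is a function of the angle. The induction has to produce a function \<open>P\<close>
  on the plane along with it, since \<open>\<mu>\<close> acts on such functions.
\<close>

lemma distribution_trig_poly:
  assumes \<mu>: "distribution \<mu>" and M: "circle_measure M"
    and coeff: "\<And>k. fourier_coeff \<mu> k = (LINT z|M. z powi (- k))"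
    and "trig_poly p"
  shows "\<exists>P. (\<forall>t. P (cis t) = p t) \<and> \<mu> P = (LINT z|M. P z)"
  using assms(4)
proof (induction rule: trig_poly.induct)
  case (monom c k)
  have "\<mu> (\<lambda>z. c * z powi k) = c * \<mu> (\<lambda>z. z powi k)"
    by (rule distribution_cmult[OF \<mu> smooth_on_circle_powi])
  also have "\<mu> (\<lambda>z. z powi k) = (LINT z|M. z powi k)"
    using coeff[of "- k"] by (simp add: fourier_coeff_def)
  finally show ?case
    by (intro exI[of _ "\<lambda>z. c * z powi k"]) (simp add: cis_power_int)
next
  case (add p q)
  then obtain P Q where PQ: "\<And>t. P (cis t) = p t" "\<mu> P = (LINT z|M. P z)"
    "\<And>t. Q (cis t) = q t" "\<mu> Q = (LINT z|M. Q z)" by blast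
  have smooth: "smooth_on_circle P" "smooth_on_circle Q"
    using add.hyps PQ by (simp_all add: smooth_on_circle_iff smooth_real_trig_poly)
  have "\<mu> (\<lambda>z. P z + Q z) = (LINT z|M. P z + Q z)"
    using smooth PQ
    by (simp add: distribution_add[OF \<mu>] smooth_on_circle_continuous integrable_circle_measure[OF M])
  then show ?case
    using PQ by (intro exI[of _ "\<lambda>z. P z + Q z"]) simp
qed

text \<open>
  The definition bounds \<open>\<mu> g\<close> by a sum of suprema, whose value is unspecified for unbounded functions;
  in this form only pointwise estimates are needed.
\<close>

lemma distribution_bound:
  assumes "distribution \<mu>"
  obtains C N where "C \<ge> 0" "\<And>g \<epsilon>. smooth_on_circle g \<Longrightarrow> (\<And>j t. j \<le> N \<Longrightarrow> cmod (circle_deriv j g t) \<le> \<epsilon>)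
    \<Longrightarrow> cmod (\<mu> g) \<le> C * \<epsilon>"
proof -
  obtain C N where C: "\<And>g. smooth_on_circle g \<Longrightarrow> cmod (\<mu> g) \<le> C * (\<Sum>j\<le>N. SUP t. cmod (circle_deriv j g t))"
    using assms by (auto simp: distribution_def)
  show thesis
  proof
    show "\<bar>C\<bar> * real (N + 1) \<ge> 0" by simp
    fix g \<epsilon> assume g: "smooth_on_circle g" "\<And>j t. j \<le> N \<Longrightarrow> cmod (circle_deriv j g t) \<le> \<epsilon>"
    have sup: "0 \<le> (SUP t. cmod (circle_deriv j g t))" "(SUP t. cmod (circle_deriv j g t)) \<le> \<epsilon>" if "j \<le> N" for j
    proof -
      have "bdd_above (range (\<lambda>t. cmod (circle_deriv j g t)))"
        using g(2)[OF that] by (auto intro!: bdd_aboveI2[where M = \<epsilon>])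
      then have "cmod (circle_deriv j g 0) \<le> (SUP t. cmod (circle_deriv j g t))"
        by (intro cSUP_upper) auto
      then show "0 \<le> (SUP t. cmod (circle_deriv j g t))"
        using norm_ge_zero order_trans by blast
      show "(SUP t. cmod (circle_deriv j g t)) \<le> \<epsilon>"
        using g(2)[OF that] by (intro cSUP_least) auto
    qed
    have "cmod (\<mu> g) \<le> \<bar>C\<bar> * (\<Sum>j\<le>N. SUP t. cmod (circle_deriv j g t))"
      by (rule order_trans[OF C[OF g(1)]]) (intro mult_right_mono sum_nonneg, auto intro: sup)
    also have "(\<Sum>j\<le>N. SUP t. cmod (circle_deriv j g t)) \<le> (\<Sum>j\<le>N. \<epsilon>)"
      by (intro sum_mono sup(2)) simp
    finally show "cmod (\<mu> g) \<le> \<bar>C\<bar> * real (N + 1) * \<epsilon>"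
      by (simp add: mult_left_mono mult.assoc)
  qed
qed

text \<open>
  Both functionals are continuous for the \<open>C\<close>-\<open>N\<close> norm with \<open>N\<close> large enough and agree on the monomials,
  whose span is dense.
\<close>

theorem represents_if_fourier_coeff:
  assumes \<mu>: "distribution \<mu>" and M: "circle_measure M"
    and coeff: "\<And>k. fourier_coeff \<mu> k = (LINT z|M. z powi (- k))"
  shows "represents M \<mu>"
proof -
  interpret finite_measure M using M by (simp add: circle_measure_def)
  obtain C N where C: "C \<ge> 0" "\<And>g \<epsilon>. smooth_on_circle g \<Longrightarrow> (\<And>j t. j \<le> N \<Longrightarrow> cmod (circle_deriv j g t) \<le> \<epsilon>)
    \<Longrightarrow> cmod (\<mu> g) \<le> C * \<epsilon>"
    using distribution_bound[OF \<mu>] by blast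
  have "\<mu> g = (LINT z|M. g z)" if g: "smooth_on_circle g" for g
  proof -
    have "cmod (\<mu> g - (LINT z|M. g z)) \<le> (C + measure M (space M)) * \<epsilon>" if "\<epsilon> > 0" for \<epsilon>
    proof -
      have "g (cis (t + 2 * pi)) = g (cis t)" for t
        using cis_add_2pi[of 1 t] by simp
      then obtain p where p: "trig_poly p"
        "\<And>j t. j \<le> N \<Longrightarrow> norm ((vd ^^ j) (\<lambda>t. g (cis t) - p t) t) \<le> \<epsilon>"
        using trig_poly_dense_smooth[of "\<lambda>t. g (cis t)" \<epsilon> N] g \<open>\<epsilon> > 0\<close>
        by (auto simp: smooth_on_circle_iff)
      obtain P where P: "\<And>t. P (cis t) = p t" "\<mu> P = (LINT z|M. P z)"
        using distribution_trig_poly[OF \<mu> M coeff p(1)] by blast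
      have smooth: "smooth_on_circle P"
        using p(1) P by (simp add: smooth_on_circle_iff smooth_real_trig_poly)
      define d where "d z = g z + (-1) * P z" for z
      have d: "smooth_on_circle d"
        unfolding d_def[abs_def] by (intro smooth_on_circle_add smooth_on_circle_cmult g smooth)
      have d_cis: "(\<lambda>t. d (cis t)) = (\<lambda>t. g (cis t) - p t)"
        by (simp add: d_def P)
      have \<mu>d: "\<mu> d = \<mu> g - \<mu> P"
        unfolding d_def[abs_def] using g smooth
        by (simp only: distribution_add[OF \<mu>] smooth_on_circle_cmult distribution_cmult[OF \<mu>]) simp
      have "cmod (\<mu> d) \<le> C * \<epsilon>"
        using p(2) by (intro C(2) d) (simp add: circle_deriv_eq d_cis)
      moreover have "cmod (LINT z|M. d z) \<le> measure M (space M) * \<epsilon>"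
      proof -
        have "cmod (d z) \<le> \<epsilon>" if "z \<in> sphere 0 1" for z
        proof -
          have "z \<noteq> 0" "cmod z = 1" using that by auto
          then have "cis (Arg z) = z" by (simp add: cis_Arg sgn_div_norm)
          then show ?thesis
            using p(2)[of 0 "Arg z"] fun_cong[OF d_cis, of "Arg z"] by simp
        qed
        then have "(LINT z|M. norm (d z)) \<le> (LINT z|M. \<epsilon>)"
          using M d
          by (intro integral_mono integrable_norm integrable_circle_measure smooth_on_circle_continuous)
            (auto simp: circle_measure_def)
        then show ?thesis
          by (intro order_trans[OF integral_norm_bound]) simp
      qed
      moreover have "(LINT z|M. d z) = (LINT z|M. g z) - (LINT z|M. P z)"
        unfolding d_def using g smooth
        by (simp add: smooth_on_circle_continuous integrable_circle_measure[OF M])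
      ultimately have "cmod (\<mu> d - (LINT z|M. d z)) \<le> C * \<epsilon> + measure M (space M) * \<epsilon>"
        and "\<mu> d - (LINT z|M. d z) = \<mu> g - (LINT z|M. g z)"
        using norm_triangle_ineq4[of "\<mu> d" "LINT z|M. d z"] by (simp_all add: \<mu>d P)
      then show ?thesis by (simp add: distrib_right)
    qed
    note le = this
    define K where "K = C + measure M (space M) + 1"
    have K: "K > 0" using C(1) by (simp add: K_def add_nonneg_pos)
    have "cmod (\<mu> g - (LINT z|M. g z)) \<le> 0 + \<epsilon>" if "\<epsilon> > 0" for \<epsilon>
    proof -
      have "cmod (\<mu> g - (LINT z|M. g z)) \<le> (C + measure M (space M)) * (\<epsilon> / K)"
        using K that by (intro le) simp
      also have "\<dots> \<le> K * (\<epsilon> / K)"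
        using K that by (intro mult_right_mono) (auto simp: K_def)
      finally show ?thesis using K by simp
    qed
    then have "cmod (\<mu> g - (LINT z|M. g z)) \<le> 0"
      by (rule field_le_epsilon)
    then show ?thesis by simp
  qed
  then show ?thesis
    using M by (simp add: represents_def circle_measure_def)
qed

lemma positive_distribution_if_represents:
  assumes "represents M \<mu>"
  shows "positive_distribution \<mu>"
  unfolding positive_distribution_def
proof (intro allI impI)
  fix g assume g: "smooth_on_circle g" "\<forall>z\<in>sphere 0 1. g z \<in> \<real>\<^sub>\<ge>\<^sub>0"
  have sp: "space M = sphere 0 1" using assms by (simp add: represents_def)
  have "\<mu> g = (LINT z|M. g z)"
    using assms g by (simp add: represents_def)
  also have "\<dots> = (LINT z|M. complex_of_real (Re (g z)))"
    using g(2) sp by (intro Bochner_Integration.integral_cong) (force simp: nonneg_Reals_def)+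
  also have "\<dots> = complex_of_real (LINT z|M. Re (g z))"
    by (rule integral_complex_of_real)
  finally show "\<mu> g \<in> \<real>\<^sub>\<ge>\<^sub>0"
    using g(2) sp by (auto simp: complex_nonneg_Reals_iff intro!: Bochner_Integration.integral_nonneg)
qed

section \<open>Taylor series and functional calculus\<close>

lemma fact_mult_power_le: "fact k * real (k + 1) ^ r \<le> fact (k + r)"
proof (induction r)
  case (Suc r)
  have "fact k * real (k + 1) ^ Suc r = real (k + 1) * (fact k * real (k + 1) ^ r)"
    by simp
  also have "\<dots> \<le> real (k + r + 1) * fact (k + r)"
    by (intro mult_mono Suc) auto
  finally show ?case by simp
qed simp

text \<open>
  Cauchy's estimate on the closed unit disc for the bounded function \<open>(deriv ^^ r) f\<close>, whose \<open>k\<close>-th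
  Taylor coefficient at \<open>0\<close> is \<open>taylor_coeff f (k + r)\<close> times \<open>(k + r)! / k!\<close>, a factor of size at
  least \<open>(k + 1) ^ r\<close>.
\<close>

lemma taylor_coeff_decay:
  assumes "f \<in> analytic_smooth"
  obtains B where "B \<ge> 0" "\<And>k. cmod (taylor_coeff f (k + r)) \<le> B / real (k + 1) ^ r"
proof -
  obtain F where F: "continuous_on (cball 0 1) F" "\<And>z. z \<in> ball 0 1 \<Longrightarrow> F z = (deriv ^^ r) f z"
    using assms unfolding analytic_smooth_def by blast
  have "bounded (F ` cball 0 1)"
    by (intro compact_imp_bounded compact_continuous_image F compact_cball)
  then obtain B where B: "\<And>z. z \<in> cball 0 1 \<Longrightarrow> cmod (F z) \<le> B"
    unfolding bounded_iff by blast
  have holo: "(deriv ^^ r) f holomorphic_on ball 0 1"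
    using assms by (intro holomorphic_higher_deriv) (auto simp: analytic_smooth_def)
  have F_holo: "F holomorphic_on ball 0 1"
    by (rule holomorphic_transform[OF holo]) (simp add: F(2))
  have deriv: "(deriv ^^ k) F 0 = (deriv ^^ (k + r)) f 0" for k
  proof -
    have "(deriv ^^ k) F 0 = (deriv ^^ k) ((deriv ^^ r) f) 0"
      by (rule higher_deriv_transform_within_open[OF F_holo holo open_ball _ F(2)]) auto
    then show ?thesis by (simp add: funpow_add)
  qed
  have "cmod (taylor_coeff f (k + r)) \<le> B / real (k + 1) ^ r" for k
  proof -
    have B0: "B \<ge> 0"
      using order_trans[OF norm_ge_zero B[of 0]] by simp
    have "cmod ((deriv ^^ k) F 0) \<le> fact k * B / 1 ^ k"
      by (rule Cauchy_inequality[OF F_holo F(1)]) (auto intro: B)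
    then have "cmod (taylor_coeff f (k + r)) \<le> fact k * B / fact (k + r)"
      by (simp add: taylor_coeff_def deriv norm_divide divide_right_mono)
    also have "\<dots> \<le> fact k * B / (fact k * real (k + 1) ^ r)"
      using fact_mult_power_le[of k r] B0 by (intro divide_left_mono) auto
    finally show ?thesis by simp
  qed
  moreover have "B \<ge> 0"
    using order_trans[OF norm_ge_zero B[of 0]] by simp
  ultimately show thesis using that by blast
qed

lemma summable_taylor_coeff:
  assumes "f \<in> analytic_smooth"
  shows "summable (\<lambda>k. cmod (taylor_coeff f k) * real (k + 1) ^ d)"
proof -
  \<comment> \<open>two orders of decay more than \<open>d\<close> leave the summable \<open>1 / (k + 1)\<^sup>2\<close>\<close>
  define r where "r = d + 2"
  obtain B where B: "B \<ge> 0" "\<And>k. cmod (taylor_coeff f (k + r)) \<le> B / real (k + 1) ^ r"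
    using taylor_coeff_decay[OF assms] by blast
  have "summable (\<lambda>k. cmod (taylor_coeff f (k + r)) * real (k + r + 1) ^ d)"
  proof (rule summable_comparison_test')
    show "summable (\<lambda>k. B * real (r + 1) ^ d * inverse (real (Suc k) ^ 2))"
      using inverse_power_summable[of 2, where 'a = real]
      by (intro summable_mult) (subst summable_Suc_iff, simp)
    fix k
    have "real (k + r + 1) \<le> real (r + 1) * real (k + 1)"
      by (simp add: algebra_simps)
    then have "real (k + r + 1) ^ d \<le> (real (r + 1) * real (k + 1)) ^ d"
      by (intro power_mono) auto
    then have "cmod (taylor_coeff f (k + r)) * real (k + r + 1) ^ d
        \<le> (B / real (k + 1) ^ r) * (real (r + 1) * real (k + 1)) ^ d"
      using B by (intro mult_mono) auto
    also have "\<dots> = B * real (r + 1) ^ d * inverse (real (Suc k) ^ 2)"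
      by (simp add: r_def power_add power_mult_distrib field_simps power2_eq_square del: of_nat_Suc)
    finally show "norm (cmod (taylor_coeff f (k + r)) * real (k + r + 1) ^ d)
        \<le> B * real (r + 1) ^ d * inverse (real (Suc k) ^ 2)"
      by simp
  qed
  then show ?thesis
    by (subst (asm) summable_iff_shift[of "\<lambda>k. cmod (taylor_coeff f k) * real (k + 1) ^ d" r])
qed

text \<open>
  The series converges uniformly on the closed disc, so its sum is continuous there; it agrees with
  \<open>f\<close> inside, and radial limits carry the identity to the boundary.
\<close>

lemma taylor_series_on_cball:
  assumes f: "f \<in> analytic_smooth" and z: "z \<in> cball 0 1"
  shows "(\<lambda>k. taylor_coeff f k * z ^ k) sums f z"
proof -
  define G where "G z = (\<Sum>k. taylor_coeff f k * z ^ k)" for z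
  have sm: "summable (\<lambda>k. cmod (taylor_coeff f k))"
    using summable_taylor_coeff[OF f, of 0] by simp
  have le: "norm (taylor_coeff f k * w ^ k) \<le> cmod (taylor_coeff f k)" if "w \<in> cball 0 1" for w k
    using that by (simp add: norm_mult norm_power mult_left_le power_le_one)
  have "uniform_limit (cball 0 1) (\<lambda>n w. \<Sum>k<n. taylor_coeff f k * w ^ k) G sequentially"
    unfolding G_def[abs_def] by (rule Weierstrass_m_test[OF le sm])
  then have contG: "continuous_on (cball 0 1) G"
    by (rule uniform_limit_theorem[rotated]) (auto intro!: always_eventually continuous_intros)
  have contf: "continuous_on (cball 0 1) f"
    using f by (simp add: analytic_smooth_def)
  have eq: "G w = f w" if "w \<in> ball 0 1" for w
  proof -
    have "(\<lambda>k. (deriv ^^ k) f 0 / fact k * (w - 0) ^ k) sums f w"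
      using f that by (intro holomorphic_power_series[of f 0 1]) (auto simp: analytic_smooth_def)
    then show ?thesis
      by (simp add: G_def taylor_coeff_def sums_iff)
  qed
  define w where "w n = of_real (1 - 1 / real (Suc n)) * z" for n
  have w: "w n \<in> ball 0 1" for n
  proof -
    have "cmod (w n) = (1 - 1 / real (Suc n)) * cmod z"
      unfolding w_def norm_mult norm_of_real by simp
    also have "\<dots> \<le> (1 - 1 / real (Suc n)) * 1"
      using z by (intro mult_left_mono) auto
    also have "\<dots> < 1" by simp
    finally show ?thesis by simp
  qed
  have "(\<lambda>n. 1 - 1 / real (Suc n)) \<longlonglongrightarrow> 1 - 0"
    by (intro tendsto_diff tendsto_const LIMSEQ_Suc lim_1_over_n)
  then have "w \<longlonglongrightarrow> of_real (1 - 0) * z"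
    unfolding w_def[abs_def] by (intro tendsto_mult tendsto_of_real tendsto_const)
  then have wz: "w \<longlonglongrightarrow> z" by simp
  have wcb: "w n \<in> cball 0 1" for n
    using w[of n] by simp
  have "(\<lambda>n. f (w n)) \<longlonglongrightarrow> f z"
    using continuous_on_tendsto_compose[OF contf wz z] wcb by simp
  moreover have "(\<lambda>n. G (w n)) \<longlonglongrightarrow> G z"
    using continuous_on_tendsto_compose[OF contG wz z] wcb by simp
  ultimately have "G z = f z"
    using eq[OF w] by (simp add: LIMSEQ_unique)
  moreover have "(\<lambda>k. taylor_coeff f k * z ^ k) sums G z"
    unfolding G_def
    by (rule summable_sums, rule summable_comparison_test'[OF sm]) (rule le[OF z])
  ultimately show ?thesis by simp
qed

lemma fun_calc_sums:
  assumes "m_isometry m T" "m \<ge> 1" "f \<in> analytic_smooth"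
  shows "(\<lambda>k. taylor_coeff f k *\<^sub>C (T ^^ k) x) sums fun_calc f T x"
proof -
  obtain C where C: "C \<ge> 0" "\<And>k. norm ((T ^^ k) x) \<le> C * (1 + real k) powr ((real m - 1) / 2)"
    using norm_funpow_growth[OF assms(1,2)] by blast
  have "summable (\<lambda>k. taylor_coeff f k *\<^sub>C (T ^^ k) x)"
  proof (rule summable_comparison_test')
    show "summable (\<lambda>k. C * (cmod (taylor_coeff f k) * real (k + 1) ^ m))"
      by (rule summable_mult[OF summable_taylor_coeff[OF assms(3)]])
    fix k
    have "(1 + real k) powr ((real m - 1) / 2) \<le> (1 + real k) powr real m"
      by (rule powr_mono) auto
    also have "\<dots> = real (k + 1) ^ m"
      by (subst powr_realpow) (auto simp: add.commute)
    finally have "norm ((T ^^ k) x) \<le> C * real (k + 1) ^ m"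
      using C by (meson mult_left_mono order_trans)
    then have "cmod (taylor_coeff f k) * norm ((T ^^ k) x) \<le> cmod (taylor_coeff f k) * (C * real (k + 1) ^ m)"
      by (rule mult_left_mono) simp
    then show "norm (taylor_coeff f k *\<^sub>C (T ^^ k) x) \<le> C * (cmod (taylor_coeff f k) * real (k + 1) ^ m)"
      by (simp add: norm_scaleC mult_ac)
  qed
  then show ?thesis
    unfolding fun_calc_def by (rule summable_sums)
qed

text \<open>
  By invariance of the top form, its matrix along the orbit of \<open>e\<close> is a Toeplitz matrix.
\<close>

lemma beta_form_funpow_eq_coeff:
  assumes "m_isometry m T" "m \<ge> 1"
    and "\<And>k. fourier_coeff \<nu> (int k) = beta_form (m - 1) T e ((T ^^ k) e)"
    and "\<And>k. cnj (fourier_coeff \<nu> (- int k)) = beta_form (m - 1) T e ((T ^^ k) e)"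
  shows "beta_form (m - 1) T ((T ^^ j) e) ((T ^^ l) e) = fourier_coeff \<nu> (int l - int j)"
proof (cases "l \<le> j")
  case True
  have "(T ^^ j) e = (T ^^ l) ((T ^^ (j - l)) e)"
    using True by (simp flip: funpow_add o_apply[of "T ^^ _" "T ^^ _"])
  then have "beta_form (m - 1) T ((T ^^ j) e) ((T ^^ l) e) = cnj (beta_form (m - 1) T e ((T ^^ (j - l)) e))"
    by (simp add: beta_form_top_invariant[OF assms(1,2)] beta_form_hermitian[of _ _ e] del: One_nat_def)
  also have "\<dots> = fourier_coeff \<nu> (- int (j - l))"
    by (simp only: assms(4)[symmetric] complex_cnj_cnj)
  finally show ?thesis using True by (simp add: of_nat_diff)
next
  case False
  have "(T ^^ l) e = (T ^^ j) ((T ^^ (l - j)) e)"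
    using False by (simp flip: funpow_add o_apply[of "T ^^ _" "T ^^ _"])
  then have "beta_form (m - 1) T ((T ^^ j) e) ((T ^^ l) e) = beta_form (m - 1) T e ((T ^^ (l - j)) e)"
    by (simp add: beta_form_top_invariant[OF assms(1,2)] del: One_nat_def)
  then show ?thesis using False assms(3)[of "l - j"] by (simp add: of_nat_diff del: One_nat_def)
qed

text \<open>
  For the Taylor polynomials \<open>p n\<close> of \<open>f\<close> both sides are the same finite double sum. On the left one
  passes to the limit by continuity of the form, on the right by dominated convergence.
\<close>

lemma beta_form_fun_calc:
  assumes iso: "m_isometry m T" "m \<ge> 1"
    and M: "circle_measure M"
    and coeff: "\<And>j l. beta_form (m - 1) T ((T ^^ j) e) ((T ^^ l) e) = (LINT z|M. z powi (int j - int l))"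
    and f: "f \<in> analytic_smooth"
  shows "beta_form (m - 1) T (fun_calc f T e) (fun_calc f T e) = complex_of_real (LINT z|M. (cmod (f z))\<^sup>2)"
proof -
  interpret finite_measure M using M by (simp add: circle_measure_def)
  define a where "a = taylor_coeff f"
  define x where "x n = (\<Sum>k<n. a k *\<^sub>C (T ^^ k) e)" for n
  define p where "p n z = (\<Sum>k<n. a k * z ^ k)" for n z
  have "x \<longlonglongrightarrow> fun_calc f T e"
    using fun_calc_sums[OF iso f] by (simp add: sums_def x_def[abs_def] a_def)
  then have "(\<lambda>n. beta_form (m - 1) T (x n) (x n)) \<longlonglongrightarrow> beta_form (m - 1) T (fun_calc f T e) (fun_calc f T e)"
    by (intro beta_form_tendsto m_isometryD(1)[OF iso(1)])
  moreover have "beta_form (m - 1) T (x n) (x n) = (LINT z|M. p n z * cnj (p n z))" for n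
  proof -
    have "beta_form (m - 1) T (x n) (x n) = (\<Sum>j<n. \<Sum>l<n. a j * cnj (a l) * (LINT z|M. z powi (int j - int l)))"
      by (simp add: x_def beta_form_sum[OF m_isometryD(1)[OF iso(1)]] coeff del: One_nat_def)
    also have "\<dots> = (LINT z|M. (\<Sum>j<n. \<Sum>l<n. a j * cnj (a l) * z powi (int j - int l)))"
      by (simp add: integrable_circle_measure[OF M] continuous_on_circle_powi)
    also have "\<dots> = (LINT z|M. p n z * cnj (p n z))"
    proof (rule Bochner_Integration.integral_cong[OF refl])
      fix z assume "z \<in> space M"
      then have z: "cmod z = 1" "z \<noteq> 0" using M by (auto simp: circle_measure_def)
      then have inv: "cnj z = inverse z"
        by (metis complex_norm_square inverse_unique of_real_1 one_power2)
      have "z powi (int j - int l) = z ^ j * cnj (z ^ l)" for j l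
        using z by (simp add: power_int_diff inv power_inverse divide_inverse)
      then show "(\<Sum>j<n. \<Sum>l<n. a j * cnj (a l) * z powi (int j - int l)) = p n z * cnj (p n z)"
        by (simp add: p_def sum_product mult_ac)
    qed
    finally show ?thesis .
  qed
  moreover have "(\<lambda>n. LINT z|M. p n z * cnj (p n z)) \<longlonglongrightarrow> (LINT z|M. f z * cnj (f z))"
  proof (rule integral_dominated_convergence)
    let ?S = "\<Sum>k. cmod (a k)"
    have sm: "summable (\<lambda>k. cmod (a k))"
      using summable_taylor_coeff[OF f, of 0] by (simp add: a_def)
    show "integrable M (\<lambda>z. ?S\<^sup>2)" by simp
    have "continuous_on (sphere 0 1) f"
      using f by (auto simp: analytic_smooth_def intro: continuous_on_subset)
    then show "(\<lambda>z. f z * cnj (f z)) \<in> borel_measurable M"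
      by (intro measurable_circle_measure[OF M] continuous_intros)
    show "(\<lambda>z. p n z * cnj (p n z)) \<in> borel_measurable M" for n
      unfolding p_def by (intro measurable_circle_measure[OF M] continuous_intros)
    show "AE z in M. (\<lambda>n. p n z * cnj (p n z)) \<longlonglongrightarrow> f z * cnj (f z)"
    proof (rule AE_I2)
      fix z assume "z \<in> space M"
      then have "z \<in> cball 0 1" using M by (auto simp: circle_measure_def)
      from taylor_series_on_cball[OF f this]
      have "(\<lambda>n. p n z) \<longlonglongrightarrow> f z" by (simp add: sums_def p_def a_def)
      then show "(\<lambda>n. p n z * cnj (p n z)) \<longlonglongrightarrow> f z * cnj (f z)"
        by (intro tendsto_intros)
    qed
    show "AE z in M. norm (p n z * cnj (p n z)) \<le> ?S\<^sup>2" for n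
    proof (rule AE_I2)
      fix z assume "z \<in> space M"
      then have z: "cmod z = 1" using M by (auto simp: circle_measure_def)
      have "cmod (p n z) \<le> (\<Sum>k<n. cmod (a k))"
        unfolding p_def by (rule order_trans[OF norm_sum]) (simp add: norm_mult norm_power z)
      also have "\<dots> \<le> ?S"
        by (rule sum_le_suminf[OF sm]) auto
      finally show "norm (p n z * cnj (p n z)) \<le> ?S\<^sup>2"
        by (simp add: norm_mult power2_eq_square mult_mono')
    qed
  qed
  ultimately have "beta_form (m - 1) T (fun_calc f T e) (fun_calc f T e) = (LINT z|M. f z * cnj (f z))"
    by (simp add: LIMSEQ_unique)
  also have "\<dots> = (LINT z|M. complex_of_real ((cmod (f z))\<^sup>2))"
    by (simp only: complex_norm_square)
  also have "\<dots> = complex_of_real (LINT z|M. (cmod (f z))\<^sup>2)"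
    by (rule integral_complex_of_real)
  finally show ?thesis .
qed

section \<open>The tuple of distributions of a cyclic m-isometry\<close>

theorem proposition6p1:
  fixes m :: nat
    and T :: "'a::complex_hilbert \<Rightarrow> 'a"
    and e :: 'a
    and \<mu> :: "nat \<Rightarrow> (complex \<Rightarrow> complex) \<Rightarrow> complex"
  assumes "m \<ge> 1"
    and "separable_space (euclidean :: 'a topology)"
    and "m_isometry m T"
    and "cyclic_vector T e"
    and "norm e = 1"
    and "\<And>n. n < m \<Longrightarrow> distribution (\<mu> n)"
    and "\<And>n k. n < m \<Longrightarrow>
           fourier_coeff (\<mu> n) (int k) = cinner (beta n T e) ((T ^^ k) e) \<and>
           cnj (fourier_coeff (\<mu> n) (- int k)) = cinner (beta n T e) ((T ^^ k) e)"
  shows "(\<forall>n. n + 2 \<le> m \<longrightarrow>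
            (\<exists>C::real. \<forall>k::int.
               cmod (fourier_coeff (\<mu> n) k) \<le> C * (1 + \<bar>real_of_int k\<bar>) powr ((real m - 1) / 2)))
       \<and> (fourier_coeff (\<mu> 0) 0 \<in> \<real>\<^sub>\<ge>\<^sub>0 \<and>
          (fourier_coeff (\<mu> 0) 0 = 0 \<longleftrightarrow> (\<forall>n<m. zero_distribution (\<mu> n))))
       \<and> (positive_distribution (\<mu> (m - 1)) \<and>
          (\<exists>M. represents M (\<mu> (m - 1))) \<and>
          (\<forall>M f. represents M (\<mu> (m - 1)) \<longrightarrow> f \<in> analytic_smooth \<longrightarrow>
             cinner (beta (m - 1) T (fun_calc f T e)) (fun_calc f T e)
               = complex_of_real (LINT z|M. (cmod (f z))\<^sup>2)))"
proof -
  note iso = \<open>m_isometry m T\<close> \<open>m \<ge> 1\<close>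
  note lin = m_isometryD(1)[OF iso(1)]
  note coeffs = assms(7)
  define \<nu> where "\<nu> = \<mu> (m - 1)"
  have \<nu>: "distribution \<nu>"
    using assms(6)[of "m - 1"] iso(2) by (simp add: \<nu>_def)
  have form: "beta_form (m - 1) T ((T ^^ j) e) ((T ^^ l) e) = fourier_coeff \<nu> (int l - int j)" for j l
    using coeffs[of "m - 1"] iso(2)
    by (intro beta_form_funpow_eq_coeff iso) (auto simp: \<nu>_def cinner_beta[OF lin])
  have i: "\<exists>C::real. \<forall>k::int. cmod (fourier_coeff (\<mu> n) k) \<le> C * (1 + \<bar>real_of_int k\<bar>) powr ((real m - 1) / 2)"
    if "n + 2 \<le> m" for n
  proof -
    obtain C where C: "\<And>k. norm ((T ^^ k) e) \<le> C * (1 + real k) powr ((real m - 1) / 2)"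
      using norm_funpow_growth[OF iso] by blast
    have "cmod (fourier_coeff (\<mu> n) k) \<le> norm (beta n T e) * C * (1 + \<bar>real_of_int k\<bar>) powr ((real m - 1) / 2)" for k
    proof -
      have "cmod (fourier_coeff (\<mu> n) k) = cmod (cinner (beta n T e) ((T ^^ nat \<bar>k\<bar>) e))"
      proof (cases "k \<ge> 0")
        case True
        then show ?thesis using coeffs[of n "nat \<bar>k\<bar>"] that by simp
      next
        case False
        then have "fourier_coeff (\<mu> n) k = fourier_coeff (\<mu> n) (- int (nat \<bar>k\<bar>))" by simp
        moreover have "cnj (fourier_coeff (\<mu> n) (- int (nat \<bar>k\<bar>)))
            = cinner (beta n T e) ((T ^^ nat \<bar>k\<bar>) e)"
          using coeffs[of n "nat \<bar>k\<bar>"] that by simp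
        ultimately show ?thesis by (metis complex_mod_cnj)
      qed
      also have "\<dots> \<le> norm (beta n T e) * norm ((T ^^ nat \<bar>k\<bar>) e)"
        by (rule cmod_cinner_le)
      also have "\<dots> \<le> norm (beta n T e) * (C * (1 + real (nat \<bar>k\<bar>)) powr ((real m - 1) / 2))"
        by (intro mult_left_mono C) simp
      finally show ?thesis by (simp add: mult.assoc)
    qed
    then show ?thesis by blast
  qed
  have ii: "fourier_coeff (\<mu> 0) 0 = 1"
    using coeffs[of 0 0] iso(2) assms(5) by (simp add: cinner_beta[OF lin] beta_form_0 cinner_self)
  have ii': "\<not> zero_distribution (\<mu> 0)"
  proof
    assume "zero_distribution (\<mu> 0)"
    then have "fourier_coeff (\<mu> 0) 0 = 0"
      using smooth_on_circle_powi[of 0] by (simp add: fourier_coeff_def zero_distribution_def)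
    then show False using ii by simp
  qed
  have "0 < m" using iso(2) by simp
  with ii' have ii'': "\<not> (\<forall>n<m. zero_distribution (\<mu> n))" by blast
  have "positive_definite_seq (\<lambda>k. fourier_coeff \<nu> (- k))"
    unfolding positive_definite_seq_def
  proof (intro allI)
    fix N and a :: "nat \<Rightarrow> complex"
    have "(\<Sum>j\<le>N. \<Sum>l\<le>N. a j * cnj (a l) * fourier_coeff \<nu> (- (int j - int l)))
        = beta_form (m - 1) T (\<Sum>j\<le>N. a j *\<^sub>C (T ^^ j) e) (\<Sum>l\<le>N. a l *\<^sub>C (T ^^ l) e)"
      by (simp add: beta_form_sum[OF lin] form del: One_nat_def)
    then show "(\<Sum>j\<le>N. \<Sum>l\<le>N. a j * cnj (a l) * fourier_coeff \<nu> (- (int j - int l))) \<in> \<real>\<^sub>\<ge>\<^sub>0"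
      using beta_form_top_nonneg[OF iso] by simp
  qed
  from Herglotz[OF this] obtain M where M: "circle_measure M"
    "\<And>k. (LINT z|M. z powi k) = fourier_coeff \<nu> (- k)"
    by blast
  have rep: "represents M \<nu>"
    by (rule represents_if_fourier_coeff[OF \<nu> M(1)]) (simp add: M(2))
  have calc: "cinner (beta (m - 1) T (fun_calc f T e)) (fun_calc f T e)
      = complex_of_real (LINT z|M. (cmod (f z))\<^sup>2)"
    if "represents M \<nu>" "f \<in> analytic_smooth" for M f
    unfolding cinner_beta[OF lin]
  proof (rule beta_form_fun_calc[OF iso _ _ that(2)])
    show "circle_measure M" using that(1) by (simp add: represents_def circle_measure_def)
    show "beta_form (m - 1) T ((T ^^ j) e) ((T ^^ l) e) = (LINT z|M. z powi (int j - int l))" for j l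
      using that(1) smooth_on_circle_powi[of "int j - int l"]
      by (simp add: form represents_def fourier_coeff_def del: One_nat_def)
  qed
  show ?thesis
  proof (intro conjI allI impI)
    show "fourier_coeff (\<mu> 0) 0 \<in> \<real>\<^sub>\<ge>\<^sub>0"
      by (simp add: ii)
    show "fourier_coeff (\<mu> 0) 0 = 0 \<longleftrightarrow> (\<forall>n<m. zero_distribution (\<mu> n))"
      using ii'' by (simp add: ii)
    show "positive_distribution (\<mu> (m - 1))"
      using positive_distribution_if_represents[OF rep] by (simp only: \<nu>_def)
    show "\<exists>M. represents M (\<mu> (m - 1))"
      using rep unfolding \<nu>_def by blast
  qed (use i calc[unfolded \<nu>_def] in blast)+
qed

end
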